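(* Let $A$ and $B$ be finite point sets in $\mathbb{R}^2$ with $|A|=n\ge m=|B|$. Then the combinatorial complexity (total number of vertices, edges and regions) of the partial-matching subdivision $\mathcal{D}_{B,A}$ is $O\big(n^2m^{3.5}(e\ln m+e)^m\big)$.
   Context: Write $B=\{b_1,\ldots,b_m\}$, $A=\{a_1,\ldots,a_n\}$. A matching is an injective map $\pi:B\to A$; its cost at translation $t\in\mathbb{R}^2$ is $f(\pi,t)=\sum_{i=1}^m\|b_i+t-a_{\pi(i)}\|^2=c_\pi+\langle t,d_\pi\rangle+m\|t\|^2$ with $c_\pi=\sum_i\|b_i-a_{\pi(i)}\|^2$, $d_\pi=2\sum_i(b_i-a_{\pi(i)})$. The partial-matching subdivision $\mathcal{D}_{B,A}$ is the subdivision of the plane of translations in which $t_1,t_2$ lie in the same region iff the set of injections minimizing $f(\cdot,t)$ is the same at $t_1$ and $t_2$; equivalently, the minimization diagram of the lower envelope $\min_\pi(c_\pi+\langle t,d_\pi\rangle)$. It is a convex polygonal subdivision of the plane. *)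

theory Defs
  imports "HOL-Analysis.Analysis" "HOL-Library.FuncSet"
begin

definition matchings :: "(real^2) set \<Rightarrow> (real^2) set \<Rightarrow> ((real^2) \<Rightarrow> (real^2)) set" where
  "matchings B A = {\<pi>. \<pi> \<in> B \<rightarrow>\<^sub>E A \<and> inj_on \<pi> B}"

definition match_cost :: "(real^2) set \<Rightarrow> ((real^2) \<Rightarrow> (real^2)) \<Rightarrow> real^2 \<Rightarrow> real" where
  "match_cost B \<pi> t = (\<Sum>b\<in>B. (norm (b + t - \<pi> b))^2)"

definition optimal_matchings :: "(real^2) set \<Rightarrow> (real^2) set \<Rightarrow> real^2 \<Rightarrow> ((real^2) \<Rightarrow> (real^2)) set" where
  "optimal_matchings B A t =
     {\<pi> \<in> matchings B A. \<forall>\<sigma> \<in> matchings B A. match_cost B \<pi> t \<le> match_cost B \<sigma> t}"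

text \<open>Faces (vertices, edges, regions) of the partial-matching subdivision D_{B,A}:
  the classes of translations sharing the same set of optimal matchings; each class is
  identified with that set. The combinatorial complexity is the number of faces.\<close>
definition pm_faces :: "(real^2) set \<Rightarrow> (real^2) set \<Rightarrow> ((real^2) \<Rightarrow> (real^2)) set set" where
  "pm_faces B A = optimal_matchings B A ` UNIV"

definition pm_complexity :: "(real^2) set \<Rightarrow> (real^2) set \<Rightarrow> nat" where
  "pm_complexity B A = card (pm_faces B A)"

end

theory Submission
  imports Defs
begin

text \<open>
  Up to a summand that does not depend on the matching, the cost is an affine function of \<open>t\<close>, so the
  faces to be counted are those of a lower envelope of affine functions on the plane. Such an envelope has
  linearly many faces, hence it suffices to count the affine functions that are minimal at a generic
  translation. These are determined by the image of the matching.

  At an optimal matching \<open>\<pi>\<close>, all points of \<open>A\<close> closer to \<open>b + t\<close> than \<open>\<pi> b\<close> are used. So the image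
  is a union, over \<open>b\<close>, of initial segments of the list of points of \<open>A\<close> ordered by distance to \<open>b + t\<close>.
  If these lists are fixed, at most \<open>4 ^ m\<close> sets of size \<open>m\<close> arise in this way. The first \<open>m\<close> entries of the
  lists change only across bisectors of pairs lying on a circle with fewer than \<open>m\<close> points inside. There are
  \<open>O(n 2 ^ m)\<close> such pairs, hence \<open>O(m n 2 ^ m)\<close> lines, which cut the plane into \<open>O(m\<^sup>2 n\<^sup>2 4 ^ m)\<close> cells.
  The resulting bound \<open>O(m\<^sup>2 n\<^sup>2 16 ^ m)\<close> is stronger than the claim because \<open>ln m\<close> is unbounded.
\<close>

section \<open>Faces of a lower envelope\<close>

definition affine_val :: "real \<times> 'a::euclidean_space \<Rightarrow> 'a \<Rightarrow> real" where
  "affine_val g t = fst g + snd g \<bullet> t"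

text \<open>This set serves as the label of the face containing \<open>t\<close>, so the faces of
  the envelope are counted by \<open>card (range (minimizers G))\<close>.\<close>

definition minimizers :: "(real \<times> 'a::euclidean_space) set \<Rightarrow> 'a \<Rightarrow> (real \<times> 'a) set" where
  "minimizers G t = {g \<in> G. \<forall>h\<in>G. affine_val g t \<le> affine_val h t}"

lemma affine_val_line: "affine_val g (p + s *\<^sub>R v) = affine_val g p + s * (snd g \<bullet> v)"
  by (simp add: affine_val_def inner_simps)

lemma affine_val_diff: "affine_val g q - affine_val g p = snd g \<bullet> (q - p)"
  by (simp add: affine_val_def inner_simps)

lemma affine_val_agree:
  assumes "affine_val g p = affine_val h p"
  shows "affine_val g q = affine_val h q \<longleftrightarrow> snd g \<bullet> (q - p) = snd h \<bullet> (q - p)"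
  using assms by (auto simp: affine_val_def inner_simps)

lemma continuous_affine_val [continuous_intros]: "continuous_on S (affine_val g)"
  unfolding affine_val_def by (intro continuous_intros)

lemma minimizersD:
  "g \<in> minimizers G t \<Longrightarrow> g \<in> G"
  "g \<in> minimizers G t \<Longrightarrow> h \<in> G \<Longrightarrow> affine_val g t \<le> affine_val h t"
  by (auto simp: minimizers_def)

lemma minimizers_eq: "g \<in> minimizers G t \<Longrightarrow> h \<in> minimizers G t \<Longrightarrow> affine_val g t = affine_val h t"
  by (meson minimizersD antisym)

lemma minimizersI_eq:
  "g \<in> minimizers G t \<Longrightarrow> h \<in> G \<Longrightarrow> affine_val h t = affine_val g t \<Longrightarrow> h \<in> minimizers G t"
  by (auto simp: minimizers_def)

lemma finite_minimizers: "finite G \<Longrightarrow> finite (minimizers G t)"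
  by (simp add: minimizers_def)

lemma minimizers_nonempty:
  assumes "finite G" "G \<noteq> {}"
  shows "minimizers G t \<noteq> {}"
proof -
  obtain g where "is_arg_min (\<lambda>g. affine_val g t) (\<lambda>g. g \<in> G) g"
    using ex_is_arg_min_if_finite[OF assms] by blast
  then have "g \<in> minimizers G t" by (auto simp: minimizers_def is_arg_min_def not_less)
  then show ?thesis by blast
qed

text \<open>Affine functions interpolate linearly along a segment, so inequalities holding at both
  ends hold in between. In other words, closed faces are convex.\<close>

lemma minimizers_segment:
  assumes "K \<subseteq> minimizers G p" "K \<subseteq> minimizers G q" "0 \<le> s" "s \<le> 1"
  shows "K \<subseteq> minimizers G (p + s *\<^sub>R (q - p))"
proof
  fix g assume g: "g \<in> K"
  have "affine_val g (p + s *\<^sub>R (q - p)) \<le> affine_val h (p + s *\<^sub>R (q - p))" if "h \<in> G" for h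
  proof -
    have comb: "affine_val k (p + s *\<^sub>R (q - p)) = (1 - s) * affine_val k p + s * affine_val k q" for k
      by (simp add: affine_val_def inner_simps algebra_simps)
    have "affine_val g p \<le> affine_val h p" "affine_val g q \<le> affine_val h q"
      using assms g that minimizersD(2) by blast+
    then show ?thesis
      unfolding comb using assms(3,4) by (intro add_mono mult_left_mono) auto
  qed
  then show "g \<in> minimizers G (p + s *\<^sub>R (q - p))"
    using assms g by (auto simp: minimizers_def)
qed

text \<open>The finitely many strict inequalities at \<open>p\<close> persist nearby by continuity,
  so a small move can only remove functions from the label.\<close>

lemma minimizers_locally_subset:
  assumes "finite G"
  shows "\<exists>S. open S \<and> p \<in> S \<and> (\<forall>q\<in>S. minimizers G q \<subseteq> minimizers G p)"
proof -
  define P where "P = {(g, h). g \<in> G \<and> h \<in> G \<and> affine_val g p < affine_val h p}"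
  define S where "S = (\<Inter>z\<in>P. {q. affine_val (fst z) q < affine_val (snd z) q})"
  have "finite P" unfolding P_def
    by (rule finite_subset[of _ "G \<times> G"]) (use assms in auto)
  then have "open S" unfolding S_def
    by (intro open_INT) (auto intro!: open_Collect_less continuous_affine_val)
  moreover have "p \<in> S" by (auto simp: S_def P_def)
  moreover have "minimizers G q \<subseteq> minimizers G p" if "q \<in> S" for q
  proof
    fix h assume h: "h \<in> minimizers G q"
    show "h \<in> minimizers G p"
    proof (rule ccontr)
      assume "h \<notin> minimizers G p"
      then obtain g where g: "g \<in> G" "affine_val g p < affine_val h p"
        using h by (force simp: minimizers_def)
      then have "(g, h) \<in> P" using h by (simp add: P_def minimizers_def)
      then have "affine_val g q < affine_val h q"
        using that unfolding S_def by fastforce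
      then show False using h g by (force simp: minimizers_def)
    qed
  qed
  ultimately show ?thesis by blast
qed

text \<open>Near \<open>p\<close> only the minimizers at \<open>p\<close> compete, and these change
  at the same rate along \<open>v\<close>, so none of them drops out.\<close>

lemma minimizers_locally_constant:
  assumes "finite G" and agree: "\<And>g h. g \<in> minimizers G p \<Longrightarrow> h \<in> minimizers G p \<Longrightarrow> snd g \<bullet> v = snd h \<bullet> v"
  shows "\<exists>e>0. \<forall>s. \<bar>s\<bar> \<le> e \<longrightarrow> minimizers G (p + s *\<^sub>R v) = minimizers G p"
proof (cases "G = {}")
  case True
  then show ?thesis by (auto simp: minimizers_def intro: exI[of _ 1])
next
  case False
  obtain S where S: "open S" "p \<in> S" "\<And>q. q \<in> S \<Longrightarrow> minimizers G q \<subseteq> minimizers G p"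
    using minimizers_locally_subset[OF assms(1), of p] by metis
  obtain d where d: "d > 0" "cball p d \<subseteq> S"
    using S(1,2) open_contains_cball[of S] by metis
  \<comment> \<open>Adding 1 to the norm covers the case \<open>v = 0\<close>.\<close>
  define e where "e = d / (norm v + 1)"
  have "e > 0" using d by (simp add: e_def add_nonneg_pos)
  moreover have "minimizers G (p + s *\<^sub>R v) = minimizers G p" if "\<bar>s\<bar> \<le> e" for s
  proof -
    have "\<bar>s\<bar> * norm v \<le> e * (norm v + 1)"
      using that \<open>e > 0\<close> by (intro mult_mono) auto
    also have "\<dots> = d" by (simp add: e_def add_nonneg_eq_0_iff)
    finally have "p + s *\<^sub>R v \<in> S" using d by (auto simp: dist_norm)
    then have sub: "minimizers G (p + s *\<^sub>R v) \<subseteq> minimizers G p" by (rule S(3))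
    obtain g where g: "g \<in> minimizers G (p + s *\<^sub>R v)"
      using minimizers_nonempty[OF assms(1) False, of "p + s *\<^sub>R v"] by blast
    have "h \<in> minimizers G (p + s *\<^sub>R v)" if "h \<in> minimizers G p" for h
    proof (rule minimizersI_eq[OF g minimizersD(1)[OF that]])
      have "g \<in> minimizers G p" using g sub by blast
      then show "affine_val h (p + s *\<^sub>R v) = affine_val g (p + s *\<^sub>R v)"
        using that agree[of g h] minimizers_eq[of g G p h] by (simp add: affine_val_line)
    qed
    with sub show ?thesis by blast
  qed
  ultimately show ?thesis by blast
qed

section \<open>Envelopes over the plane in sheared coordinates\<close>

lemma eq_real2_iff: "p = q \<longleftrightarrow> p $ 1 = q $ 1 \<and> p $ 2 = q $ 2" for p q :: "real^2"
  by (simp add: vec_eq_iff forall_2)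

lemma inner_real2: "p \<bullet> q = p $ 1 * q $ 1 + p $ 2 * q $ 2" for p q :: "real^2"
  by (simp add: inner_vec_def sum_2)

text \<open>The last assumption, achieved by a shear, makes no edge of the envelope horizontal.\<close>

locale sheared_family =
  fixes G :: "(real \<times> (real^2)) set"
  assumes fin: "finite G" and ne: "G \<noteq> {}"
    and shear: "g \<in> G \<Longrightarrow> h \<in> G \<Longrightarrow> snd g $ 1 = snd h $ 1 \<Longrightarrow> snd g = snd h"
begin

abbreviation M where "M \<equiv> minimizers G"

text \<open>Equal first slopes force equal gradients by \<open>shear\<close>, and equal values at
  \<open>p\<close> then force equal constants. So the first slope orders \<open>M p\<close>
  linearly.\<close>

lemma slope_inj: "g \<in> M p \<Longrightarrow> h \<in> M p \<Longrightarrow> snd g $ 1 = snd h $ 1 \<Longrightarrow> g = h"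
  using shear[of g h] minimizers_eq[of g G p h]
  by (auto simp: minimizersD affine_val_def prod_eq_iff)

text \<open>The function of largest first slope is the one that is minimal immediately to the left of \<open>p\<close>.\<close>

definition leftmost where
  "leftmost g p \<longleftrightarrow> g \<in> M p \<and> (\<forall>h\<in>M p. snd h $ 1 \<le> snd g $ 1)"

lemma ex_leftmost: "\<exists>g. leftmost g p"
proof -
  have "finite (M p)" "M p \<noteq> {}" using fin ne by (auto simp: finite_minimizers minimizers_nonempty)
  then obtain g where "is_arg_min (\<lambda>g. - (snd g $ 1)) (\<lambda>g. g \<in> M p) g"
    using ex_is_arg_min_if_finite by blast
  then show ?thesis unfolding leftmost_def is_arg_min_def by (intro exI[of _ g]) force
qed

lemma ex_rightmost: "\<exists>g\<in>M p. \<forall>h\<in>M p. snd g $ 1 \<le> snd h $ 1"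
proof -
  have "finite (M p)" "M p \<noteq> {}" using fin ne by (auto simp: finite_minimizers minimizers_nonempty)
  then obtain g where "is_arg_min (\<lambda>g. snd g $ 1) (\<lambda>g. g \<in> M p) g"
    using ex_is_arg_min_if_finite by blast
  then show ?thesis unfolding is_arg_min_def by (intro bexI[of _ g]) force+
qed

lemma leftmost_unique: "leftmost g p \<Longrightarrow> leftmost h p \<Longrightarrow> g = h"
  unfolding leftmost_def by (meson slope_inj antisym)

text \<open>The points \<open>q\<close> with \<open>M p \<subseteq> M q\<close> form the closed face
  of \<open>p\<close>; a vertex is a closed face that is a single point.\<close>

definition vertex where
  "vertex p \<longleftrightarrow> (\<forall>q. M p \<subseteq> M q \<longrightarrow> q = p)"

lemma not_vertexI:
  assumes "v \<noteq> 0" "\<And>g h. g \<in> M p \<Longrightarrow> h \<in> M p \<Longrightarrow> snd g \<bullet> v = snd h \<bullet> v"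
  shows "\<not> vertex p"
proof -
  obtain e where "e > 0" "\<And>s. \<bar>s\<bar> \<le> e \<Longrightarrow> M (p + s *\<^sub>R v) = M p"
    using minimizers_locally_constant[OF fin] assms(2) by metis
  then have "M (p + e *\<^sub>R v) = M p" "p + e *\<^sub>R v \<noteq> p" using assms(1) by auto
  then show ?thesis unfolding vertex_def by blast
qed

text \<open>Any function whose first slope lies strictly between the extreme ones and whose gradient is off the line
  joining the two extreme gradients will do.\<close>

lemma vertex_extremal:
  assumes "vertex p"
  shows "\<exists>g\<in>M p. (\<forall>q. g \<in> M q \<longrightarrow> q = p \<or> q $ 2 < p $ 2) \<or> (\<forall>q. g \<in> M q \<longrightarrow> q = p \<or> q $ 2 > p $ 2)"
proof -
  obtain l where l: "leftmost l p" using ex_leftmost by blast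
  obtain r where r: "r \<in> M p" "\<And>h. h \<in> M p \<Longrightarrow> snd r $ 1 \<le> snd h $ 1" using ex_rightmost by blast
  have lM: "l \<in> M p" "\<And>h. h \<in> M p \<Longrightarrow> snd h $ 1 \<le> snd l $ 1" using l by (auto simp: leftmost_def)
  \<comment> \<open>A vector orthogonal to \<open>snd r - snd l\<close>, so that the inner product
    below tests whether a gradient is off the line through the two extreme ones.\<close>
  define v :: "real^2" where "v = vector [snd r $ 2 - snd l $ 2, snd l $ 1 - snd r $ 1]"
  have v12: "v $ 1 = snd r $ 2 - snd l $ 2" "v $ 2 = snd l $ 1 - snd r $ 1"
    by (simp_all add: v_def)
  have "\<exists>g\<in>M p. (snd g - snd l) \<bullet> v \<noteq> 0"
  proof (rule ccontr)
    assume "\<not> ?thesis"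
    then have all: "\<And>g. g \<in> M p \<Longrightarrow> snd g \<bullet> v = snd l \<bullet> v" by (auto simp: inner_simps)
    show False
    proof (cases "l = r")
      case True
      then have "\<And>g. g \<in> M p \<Longrightarrow> g = l" using lM r slope_inj by (meson antisym)
      then have "\<not> vertex p" by (intro not_vertexI[of "axis 1 1"]) (simp, metis)
      then show False using assms by blast
    next
      case False
      then have "v \<noteq> 0" using slope_inj[of l p r] lM r v12 by (auto simp: eq_real2_iff)
      then show False using not_vertexI[of v p] assms all by metis
    qed
  qed
  then obtain g where g: "g \<in> M p" "(snd g - snd l) \<bullet> v \<noteq> 0" by blast
  have "g \<noteq> l" using g by auto
  moreover have "g \<noteq> r" using g by (auto simp: inner_real2 v12 algebra_simps)
  ultimately have lt: "snd r $ 1 < snd g $ 1" "snd g $ 1 < snd l $ 1"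
    using slope_inj[of g p l] slope_inj[of g p r] g(1) lM(1) r(1) lM(2)[OF g(1)] r(2)[OF g(1)]
    by (auto simp: less_le)
  \<comment> \<open>Positive weights for which the combination of the two inequalities against
    \<open>l\<close> and \<open>r\<close> loses its first coordinate and bounds the sign of the
    second.\<close>
  define a b where "a = snd g $ 1 - snd r $ 1" and "b = snd l $ 1 - snd g $ 1"
  have ab: "a > 0" "b > 0" using lt by (auto simp: a_def b_def)
  have key: "(q - p) $ 2 * ((snd g - snd l) \<bullet> v) \<le> 0" "(q - p) $ 2 = 0 \<longrightarrow> q = p" if "g \<in> M q" for q
  proof -
    define w where "w = q - p"
    have le: "(snd g - snd h) \<bullet> w \<le> 0" if "h \<in> M p" for h
      using minimizers_eq[OF g(1) that] minimizersD(2)[OF \<open>g \<in> M q\<close> minimizersD(1)[OF that]]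
      by (simp add: w_def affine_val_def inner_simps)
    have 1: "(snd g $ 1 - snd l $ 1) * w $ 1 + (snd g $ 2 - snd l $ 2) * w $ 2 \<le> 0"
      and 2: "(snd g $ 1 - snd r $ 1) * w $ 1 + (snd g $ 2 - snd r $ 2) * w $ 2 \<le> 0"
      using le[OF lM(1)] le[OF r(1)] by (simp_all add: inner_real2)
    have "a * ((snd g $ 1 - snd l $ 1) * w $ 1 + (snd g $ 2 - snd l $ 2) * w $ 2)
        + b * ((snd g $ 1 - snd r $ 1) * w $ 1 + (snd g $ 2 - snd r $ 2) * w $ 2) \<le> 0"
      using mult_left_mono[OF 1, of a] mult_left_mono[OF 2, of b] ab by simp
    moreover have "a * ((snd g $ 1 - snd l $ 1) * w $ 1 + (snd g $ 2 - snd l $ 2) * w $ 2)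
        + b * ((snd g $ 1 - snd r $ 1) * w $ 1 + (snd g $ 2 - snd r $ 2) * w $ 2)
        = w $ 2 * ((snd g - snd l) \<bullet> v)"
      by (simp add: a_def b_def inner_real2 v12 algebra_simps)
    ultimately show "(q - p) $ 2 * ((snd g - snd l) \<bullet> v) \<le> 0" by (simp add: w_def)
    show "(q - p) $ 2 = 0 \<longrightarrow> q = p"
    proof
      assume "(q - p) $ 2 = 0"
      then have w2: "w $ 2 = 0" by (simp add: w_def)
      then have "b * w $ 1 \<ge> 0" "a * w $ 1 \<le> 0" using 1 2 by (auto simp: a_def b_def algebra_simps)
      then have "w $ 1 = 0" using ab by (simp add: zero_le_mult_iff mult_le_0_iff)
      with w2 show "q = p" by (auto simp: w_def eq_real2_iff)
    qed
  qed
  have "q = p \<or> q $ 2 < p $ 2" if "(snd g - snd l) \<bullet> v > 0" "g \<in> M q" for q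
    using key[OF that(2)] that(1) by (auto simp: mult_le_0_iff)
  moreover have "q = p \<or> q $ 2 > p $ 2" if "(snd g - snd l) \<bullet> v < 0" "g \<in> M q" for q
    using key[OF that(2)] that(1) by (auto simp: mult_le_0_iff)
  ultimately show ?thesis using g by (meson linorder_neqE_linordered_idom)
qed

text \<open>By \<open>vertex_extremal\<close> each vertex is the unique highest or the unique lowest
  point at which some function is minimal. The Boolean records which (\<open>True\<close> for
  highest), and a function has at most one point of each kind.\<close>

lemma vertices_card: "finite (Collect vertex)" "card (Collect vertex) \<le> 2 * card G"
proof -
  have "\<exists>z\<in>G \<times> (UNIV::bool set). fst z \<in> M p \<and>
      (\<forall>q. fst z \<in> M q \<longrightarrow> q = p \<or> (if snd z then q $ 2 < p $ 2 else q $ 2 > p $ 2))"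
    if vertex_p: "vertex p" for p
  proof -
    obtain g where g: "g \<in> M p" "(\<forall>q. g \<in> M q \<longrightarrow> q = p \<or> q $ 2 < p $ 2) \<or> (\<forall>q. g \<in> M q \<longrightarrow> q = p \<or> q $ 2 > p $ 2)"
      using vertex_extremal[OF vertex_p] by blast
    then show ?thesis using minimizersD(1)[OF g(1)]
      by (intro bexI[of _ "(g, \<forall>q. g \<in> M q \<longrightarrow> q = p \<or> q $ 2 < p $ 2)"]) auto
  qed
  then obtain f where f: "\<And>p. vertex p \<Longrightarrow> f p \<in> G \<times> (UNIV::bool set)"
    "\<And>p. vertex p \<Longrightarrow> fst (f p) \<in> M p"
    "\<And>p q. vertex p \<Longrightarrow> fst (f p) \<in> M q \<Longrightarrow> q = p \<or> (if snd (f p) then q $ 2 < p $ 2 else q $ 2 > p $ 2)"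
    by metis
  have inj: "inj_on f (Collect vertex)"
  proof (rule inj_onI)
    fix p q assume "p \<in> Collect vertex" "q \<in> Collect vertex" "f p = f q"
    then show "p = q" using f(2)[of p] f(2)[of q] f(3)[of p q] f(3)[of q p]
      by (auto split: if_splits)
  qed
  have "f ` Collect vertex \<subseteq> G \<times> UNIV" using f(1) by blast
  then show "finite (Collect vertex)" "card (Collect vertex) \<le> 2 * card G"
    using inj_on_finite[OF inj, of "G \<times> UNIV"] card_inj_on_le[OF inj, of "G \<times> UNIV"] fin
    by (auto simp: card_cartesian_product)
qed

section \<open>Counting edges\<close>

definition edge where
  "edge p \<longleftrightarrow> \<not> vertex p \<and> (\<exists>g\<in>M p. \<exists>h\<in>M p. g \<noteq> h)"

lemma edge_other:
  assumes "\<exists>g\<in>M p. \<exists>h\<in>M p. g \<noteq> h" "leftmost g p"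
  obtains h where "h \<in> M p" "snd h $ 1 < snd g $ 1"
proof -
  obtain h where "h \<in> M p" "h \<noteq> g" using assms(1) by metis
  moreover have "g \<in> M p" "snd h $ 1 \<le> snd g $ 1"
    using assms(2) \<open>h \<in> M p\<close> by (auto simp: leftmost_def)
  ultimately show thesis using slope_inj[of h p g] that[of h] by linarith
qed

text \<open>Moving right from \<open>p\<close> horizontally, \<open>h\<close> falls below
  \<open>g\<close> because its first slope is smaller. Hence \<open>p\<close> is the right end of
  the region of \<open>g\<close> at its height.\<close>

lemma left_of_boundary:
  assumes "g \<in> M p" "h \<in> M p" "snd h $ 1 < snd g $ 1" "g \<in> M q" "q $ 2 = p $ 2"
  shows "q $ 1 \<le> p $ 1"
proof -
  have "affine_val g q \<le> affine_val h q" "affine_val g p = affine_val h p"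
    using assms minimizersD minimizers_eq by blast+
  then have "(snd g $ 1 - snd h $ 1) * (q $ 1 - p $ 1) \<le> 0"
    using assms(5) by (simp add: affine_val_def inner_real2 algebra_simps)
  then show ?thesis using assms(3) by (simp add: mult_le_0_iff)
qed

text \<open>Both \<open>v\<close> and \<open>q - p\<close> are orthogonal to the nonzero vector
  \<open>snd g - snd h\<close>, hence parallel. The conclusion is written without division, so it
  also covers \<open>v $ 2 = 0\<close>.\<close>

lemma common_line:
  assumes "g \<in> M p" "h \<in> M p" "g \<in> M q" "h \<in> M q" "g \<noteq> h"
    and "snd g \<bullet> v = snd h \<bullet> v"
  shows "(v $ 2) *\<^sub>R (q - p) = ((q - p) $ 2) *\<^sub>R v"
proof -
  have s: "snd g $ 1 - snd h $ 1 \<noteq> 0" using assms slope_inj[of g p h] by auto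
  have "affine_val g p = affine_val h p" "affine_val g q = affine_val h q"
    using assms minimizers_eq by blast+
  then have "snd g \<bullet> (q - p) = snd h \<bullet> (q - p)" using affine_val_agree by blast
  then have 1: "(snd g $ 1 - snd h $ 1) * (q - p) $ 1 = - (snd g $ 2 - snd h $ 2) * (q - p) $ 2"
    and 2: "(snd g $ 1 - snd h $ 1) * v $ 1 = - (snd g $ 2 - snd h $ 2) * v $ 2"
    using assms(6) by (auto simp: inner_real2 algebra_simps)
  have "(snd g $ 1 - snd h $ 1) * (v $ 2 * (q - p) $ 1) = v $ 2 * ((snd g $ 1 - snd h $ 1) * (q - p) $ 1)"
    by simp
  also have "\<dots> = (q - p) $ 2 * ((snd g $ 1 - snd h $ 1) * v $ 1)"
    unfolding 1 2 by simp
  finally have "(snd g $ 1 - snd h $ 1) * (v $ 2 * (q - p) $ 1) = (snd g $ 1 - snd h $ 1) * ((q - p) $ 2 * v $ 1)"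
    by simp
  with s have "v $ 2 * (q - p) $ 1 = (q - p) $ 2 * v $ 1" by simp
  then show ?thesis by (simp add: eq_real2_iff)
qed

text \<open>A non-vertex has a second point \<open>q\<close> in its closed face. The step
  \<open>q - p\<close> is not horizontal, since distinct minimizers have distinct first slopes, and
  can be scaled to height 1.\<close>

lemma edge_direction:
  assumes "edge p"
  obtains w where "w $ 2 = 1" "\<And>g h. g \<in> M p \<Longrightarrow> h \<in> M p \<Longrightarrow> snd g \<bullet> w = snd h \<bullet> w"
proof -
  obtain q where q: "q \<noteq> p" "M p \<subseteq> M q" using assms by (auto simp: edge_def vertex_def)
  obtain g h where gh: "g \<in> M p" "h \<in> M p" "g \<noteq> h" using assms by (auto simp: edge_def)
  have agree: "snd g \<bullet> (q - p) = snd h \<bullet> (q - p)" if "g \<in> M p" "h \<in> M p" for g h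
    using that q affine_val_agree[of g p h q] minimizers_eq by blast
  have "(q - p) $ 2 \<noteq> 0"
  proof
    assume "(q - p) $ 2 = 0"
    then have "(snd g $ 1 - snd h $ 1) * (q - p) $ 1 = 0"
      using agree[OF gh(1,2)] by (simp add: inner_real2 algebra_simps)
    then have "(q - p) $ 1 = 0" using slope_inj[of g p h] gh by auto
    then show False using q \<open>(q - p) $ 2 = 0\<close> by (auto simp: eq_real2_iff)
  qed
  then show thesis
  proof (intro that[of "(1 / (q - p) $ 2) *\<^sub>R (q - p)"])
    fix g h assume "g \<in> M p" "h \<in> M p"
    then have "snd g \<bullet> (q - p) = snd h \<bullet> (q - p)" by (rule agree)
    then show "snd g \<bullet> (1 / (q - p) $ 2) *\<^sub>R (q - p) = snd h \<bullet> (1 / (q - p) $ 2) *\<^sub>R (q - p)"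
      unfolding inner_scaleR_right by (rule arg_cong)
  qed auto
qed

text \<open>Two functions minimal at both points put \<open>p'\<close> on the line through
  \<open>p\<close> along which all minimizers at \<open>p\<close> agree. So all of them are minimal
  at \<open>p'\<close> as well.\<close>

lemma edge_subset_eq:
  assumes "M p' \<subseteq> M p" "edge p" "edge p'"
  shows "M p = M p'"
proof -
  obtain w where w: "w $ 2 = 1" "\<And>g h. g \<in> M p \<Longrightarrow> h \<in> M p \<Longrightarrow> snd g \<bullet> w = snd h \<bullet> w"
    using edge_direction[OF assms(2)] by blast
  obtain g h where gh: "g \<in> M p'" "h \<in> M p'" "g \<noteq> h" using assms by (auto simp: edge_def)
  then have gh': "g \<in> M p" "h \<in> M p" using assms by auto
  have par: "p' - p = ((p' - p) $ 2) *\<^sub>R w"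
    using common_line[OF gh'(1,2) gh(1,2,3) w(2)[OF gh']] w(1) by simp
  have "l \<in> M p'" if l: "l \<in> M p" for l
  proof -
    have "snd l \<bullet> (p' - p) = snd g \<bullet> (p' - p)"
      using w(2)[OF l gh'(1)] by (subst (1 2) par) simp
    then have "affine_val l p' = affine_val g p'"
      using affine_val_agree minimizers_eq[OF l gh'(1)] by blast
    then show ?thesis using minimizersI_eq[OF gh(1)] l minimizersD by blast
  qed
  then show ?thesis using assms by blast
qed

text \<open>The closed edge of \<open>p'\<close> contains \<open>t\<close> and \<open>p'\<close>,
  hence a point \<open>q\<close> at the height of \<open>p\<close>. Both \<open>q\<close> and
  \<open>p\<close> are the right end of the region of \<open>g\<close> at that height, so they
  coincide.\<close>

lemma edge_eqI:
  assumes "edge p" "edge p'" "leftmost g p" "leftmost g p'"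
    and "M p' \<subseteq> M t" "t $ 2 \<le> p $ 2" "p $ 2 \<le> p' $ 2"
  shows "M p = M p'"
proof -
  obtain h h' where h: "h \<in> M p" "snd h $ 1 < snd g $ 1" "h' \<in> M p'" "snd h' $ 1 < snd g $ 1"
    using edge_other assms unfolding edge_def by metis
  have g: "g \<in> M p" "g \<in> M p'" using assms by (auto simp: leftmost_def)
  \<comment> \<open>If \<open>t\<close> and \<open>p'\<close> have equal height, then so does
    \<open>p\<close>, and \<open>s = 1\<close> selects \<open>q = p'\<close>.\<close>
  define s where "s = (if t $ 2 = p' $ 2 then 1 else (p $ 2 - t $ 2) / (p' $ 2 - t $ 2))"
  define q where "q = t + s *\<^sub>R (p' - t)"
  have s: "0 \<le> s" "s \<le> 1" using assms(6,7) by (auto simp: s_def divide_simps)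
  have q2: "q $ 2 = p $ 2" using assms(6,7) by (auto simp: q_def s_def divide_simps)
  have sub: "M p' \<subseteq> M q" unfolding q_def using assms(5) s by (intro minimizers_segment) auto
  have "q $ 1 \<le> p $ 1" using left_of_boundary[of g p h q] g h sub q2 by auto
  moreover have "p $ 1 \<le> q $ 1" using left_of_boundary[of g q h' p] g h sub q2 by auto
  ultimately have "q = p" using q2 by (auto simp: eq_real2_iff)
  then show ?thesis using sub edge_subset_eq assms by blast
qed

text \<open>Edges are charged to the region on their left if they come first on its right boundary, and to
  their lower end point otherwise.\<close>

lemma edge_cases:
  assumes e: "edge p" and l: "leftmost g p"
  obtains (first) "\<And>q. g \<in> M q \<Longrightarrow> \<exists>p'. M p \<subseteq> M p' \<and> p' $ 2 \<le> q $ 2"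
    | (below) t where "vertex t" "M p \<subseteq> M t" "t $ 2 < p $ 2" "leftmost g t"
proof (cases "\<forall>q. g \<in> M q \<longrightarrow> (\<exists>p'. M p \<subseteq> M p' \<and> p' $ 2 \<le> q $ 2)")
  case True
  then show ?thesis using first by blast
next
  case False
  then obtain q where q: "g \<in> M q" "\<And>p'. M p \<subseteq> M p' \<Longrightarrow> q $ 2 < p' $ 2" by (auto simp: not_le)
  obtain w where w: "w $ 2 = 1" "\<And>g h. g \<in> M p \<Longrightarrow> h \<in> M p \<Longrightarrow> snd g \<bullet> w = snd h \<bullet> w"
    using edge_direction[OF e] by blast
  obtain h where h: "h \<in> M p" "snd h $ 1 < snd g $ 1" using edge_other[OF _ l] e edge_def by blast
  have g: "g \<in> M p" using l by (simp add: leftmost_def)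
  \<comment> \<open>The closed edge of \<open>p\<close>, parametrised by height relative to
    \<open>p\<close>. It is closed, and bounded below because it stays above \<open>q\<close>; its
    infimum gives the lower end point \<open>t\<close>.\<close>
  define I where "I = {s. M p \<subseteq> M (p + s *\<^sub>R w)}"
  have "I = (\<Inter>k\<in>M p. \<Inter>h\<in>G. {s. affine_val k p + s * (snd k \<bullet> w) \<le> affine_val h p + s * (snd h \<bullet> w)})"
    unfolding I_def by (fastforce simp: minimizers_def affine_val_line)
  then have "closed I" by (auto intro!: closed_INT closed_Collect_le continuous_intros)
  moreover have "bdd_below I"
  proof (rule bdd_belowI)
    fix s assume "s \<in> I"
    then show "q $ 2 - p $ 2 \<le> s" using q(2)[of "p + s *\<^sub>R w"] w(1) by (auto simp: I_def)
  qed
  moreover have "0 \<in> I" by (simp add: I_def)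
  ultimately have inI: "Inf I \<in> I" and low: "\<And>s. s \<in> I \<Longrightarrow> Inf I \<le> s"
    using closed_contains_Inf[of I] cInf_lower[of _ I] by blast+
  obtain e where e: "e > 0" "\<And>s. \<bar>s\<bar> \<le> e \<Longrightarrow> M (p + s *\<^sub>R w) = M p"
    using minimizers_locally_constant[OF fin, of p w] w(2) by blast
  then have "- e \<in> I" unfolding I_def using e(2)[of "- e"] by auto
  then have neg: "Inf I < 0" using low[of "- e"] e(1) by linarith
  define t where "t = p + Inf I *\<^sub>R w"
  have sub: "M p \<subseteq> M t" using inI by (simp add: I_def t_def)
  \<comment> \<open>A second point in the closed face of \<open>t\<close> would make all minimizers
    at \<open>t\<close> agree along \<open>w\<close>. The label would then be constant around
    \<open>t\<close>, and the edge would continue below its end point.\<close>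
  have vt: "vertex t" unfolding vertex_def
  proof (intro allI impI)
    fix t' assume t': "M t \<subseteq> M t'"
    show "t' = t"
    proof (rule ccontr)
      assume "t' \<noteq> t"
      have *: "t' - t = ((t' - t) $ 2) *\<^sub>R w"
        using common_line[of g t h t' w] w(1) w(2)[OF g h(1)] subsetD[OF sub g] subsetD[OF sub h(1)]
          subsetD[OF t'] h(2) by fastforce
      then have c: "(t' - t) $ 2 \<noteq> 0" using \<open>t' \<noteq> t\<close> by (metis scaleR_zero_left right_minus_eq)
      have "snd k \<bullet> w = snd k' \<bullet> w" if "k \<in> M t" "k' \<in> M t" for k k'
      proof -
        have "snd k \<bullet> (t' - t) = snd k' \<bullet> (t' - t)"
          using that t' affine_val_agree[of k t k' t'] minimizers_eq by blast
        then show ?thesis using c by (subst (asm) (1 2) *) simp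
      qed
      then obtain d where d: "d > 0" "\<And>s. \<bar>s\<bar> \<le> d \<Longrightarrow> M (t + s *\<^sub>R w) = M t"
        using minimizers_locally_constant[OF fin, of t w] by blast
      have "M (t + (- d) *\<^sub>R w) = M t" using d(1) d(2)[of "- d"] by simp
      then have "Inf I - d \<in> I" using sub by (simp add: I_def t_def algebra_simps)
      then show False using low d(1) by force
    qed
  qed
  have t2: "t $ 2 = p $ 2 + Inf I" using w by (simp add: t_def)
  \<comment> \<open>Suppose \<open>k\<close> has a larger first slope than \<open>g\<close>, and
    write \<open>q - t\<close> as a step down along \<open>w\<close> plus a horizontal step
    \<open>y\<close>. Comparing \<open>g\<close> with \<open>k\<close> at \<open>p\<close> gives
    \<open>x \<le> 0\<close>, and comparing \<open>g\<close> with \<open>h\<close> at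
    \<open>q\<close> gives \<open>y \<le> 0\<close>. Then \<open>g\<close> against \<open>k\<close>
    at \<open>q\<close> forces \<open>x = 0\<close>, so \<open>k\<close> is minimal at
    \<open>p\<close> too, contradicting that \<open>g\<close> is leftmost there.\<close>
  have lt: "snd k $ 1 \<le> snd g $ 1" if k: "k \<in> M t" for k
  proof (rule ccontr)
    assume "\<not> snd k $ 1 \<le> snd g $ 1"
    then have kg: "snd g $ 1 < snd k $ 1" by simp
    define x where "x = (snd g - snd k) \<bullet> w"
    define d where "d = t $ 2 - q $ 2"
    have d: "d > 0" using q(2)[OF sub] by (simp add: d_def)
    define y where "y = (q - t + d *\<^sub>R w) $ 1"
    have qt: "q - t = (- d) *\<^sub>R w + y *\<^sub>R axis 1 1"
      using w(1) by (simp add: eq_real2_iff y_def d_def axis_def algebra_simps)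
    have ax: "z \<bullet> axis 1 1 = z $ 1" for z :: "real^2" by (simp add: inner_axis)
    have eqt: "affine_val g t = affine_val k t" "affine_val g t = affine_val h t"
      using sub g h k minimizers_eq by blast+
    have "p = t + (- Inf I) *\<^sub>R w" by (simp add: t_def)
    then have "affine_val j p = affine_val j t - Inf I * (snd j \<bullet> w)" for j
      using affine_val_line[of j t "- Inf I" w] by simp
    then have pval: "affine_val g p - affine_val k p = - Inf I * x"
      using eqt by (simp add: x_def inner_simps algebra_simps)
    have "affine_val g p - affine_val k p \<le> 0" using minimizersD(2)[OF g minimizersD(1)[OF k]] by simp
    then have x: "x \<le> 0" using pval neg by (simp add: zero_le_mult_iff)
    have "affine_val g q - affine_val h q = (snd g - snd h) \<bullet> (q - t)"
      using affine_val_diff[of g q t] affine_val_diff[of h q t] eqt by (simp add: inner_diff_left)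
    also have "\<dots> = y * (snd g $ 1 - snd h $ 1)"
      using w(2)[OF g h(1)] unfolding qt by (simp add: inner_add_right inner_diff_right inner_diff_left ax algebra_simps)
    finally have "y * (snd g $ 1 - snd h $ 1) \<le> 0" using minimizersD(2)[OF q(1) minimizersD(1)[OF h(1)]] by simp
    then have y: "y \<le> 0" using h(2) by (simp add: mult_le_0_iff)
    have "affine_val g q - affine_val k q = (snd g - snd k) \<bullet> (q - t)"
      using affine_val_diff[of g q t] affine_val_diff[of k q t] eqt by (simp add: inner_diff_left)
    also have "\<dots> = - d * x + y * (snd g $ 1 - snd k $ 1)"
      unfolding qt x_def by (simp add: inner_add_right inner_diff_right inner_diff_left ax algebra_simps)
    finally have "- d * x + y * (snd g $ 1 - snd k $ 1) \<le> 0" using minimizersD(2)[OF q(1) minimizersD(1)[OF k]] by simp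
    moreover have "y * (snd g $ 1 - snd k $ 1) \<ge> 0" using y kg by (simp add: zero_le_mult_iff)
    ultimately have "- d * x \<le> 0" by linarith
    then have "x = 0" using x d by (simp add: zero_le_mult_iff)
    then have "affine_val k p = affine_val g p" using pval by simp
    then have "k \<in> M p" by (rule minimizersI_eq[OF g minimizersD(1)[OF k]])
    then have "snd k $ 1 \<le> snd g $ 1" using l unfolding leftmost_def by blast
    then show False using kg by simp
  qed
  show ?thesis
  proof (rule below[OF vt sub])
    show "t $ 2 < p $ 2" using t2 neg by simp
    show "leftmost g t" unfolding leftmost_def using lt sub g by blast
  qed
qed

lemma edges_card: "card (M ` Collect edge) \<le> card G + card (Collect vertex)"
proof -
  \<comment> \<open>The charging relation: \<open>Inl g\<close> is the region to the left of the
    edge, \<open>Inr t\<close> its lower end point.\<close>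
  define R where "R e z \<longleftrightarrow> (\<exists>p g. edge p \<and> e = M p \<and> leftmost g p \<and>
     ((z = Inl g \<and> (\<forall>q. g \<in> M q \<longrightarrow> (\<exists>p'. M p \<subseteq> M p' \<and> p' $ 2 \<le> q $ 2))) \<or>
      (\<exists>t. z = Inr t \<and> vertex t \<and> M p \<subseteq> M t \<and> t $ 2 < p $ 2 \<and> leftmost g t)))" for e z
  have "\<exists>z \<in> G <+> Collect vertex. R e z" if "e \<in> M ` Collect edge" for e
  proof -
    obtain p where p: "edge p" "e = M p" using \<open>e \<in> M ` Collect edge\<close> by auto
    obtain g where g: "leftmost g p" using ex_leftmost by blast
    have gG: "g \<in> G" using g minimizersD(1)[of g G p] by (simp add: leftmost_def)
    show ?thesis
    proof (cases rule: edge_cases[OF p(1) g])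
      case 1
      then have "R e (Inl g)" unfolding R_def using p g by blast
      then show ?thesis using gG by blast
    next
      case (2 t)
      then have "R e (Inr t)" unfolding R_def using p g by blast
      then show ?thesis using 2 by blast
    qed
  qed
  then obtain f where f: "\<And>e. e \<in> M ` Collect edge \<Longrightarrow> f e \<in> G <+> Collect vertex \<and> R e (f e)"
    by metis
  have same: "e = e'" if "R e z" "R e' z" for e e' z
  proof -
    obtain p g where p: "edge p" "e = M p" "leftmost g p" and
      z: "(z = Inl g \<and> (\<forall>q. g \<in> M q \<longrightarrow> (\<exists>p'. M p \<subseteq> M p' \<and> p' $ 2 \<le> q $ 2))) \<or>
      (\<exists>t. z = Inr t \<and> vertex t \<and> M p \<subseteq> M t \<and> t $ 2 < p $ 2 \<and> leftmost g t)"
      using \<open>R e z\<close> unfolding R_def by blast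
    obtain p' g' where p': "edge p'" "e' = M p'" "leftmost g' p'" and
      z': "(z = Inl g' \<and> (\<forall>q. g' \<in> M q \<longrightarrow> (\<exists>p. M p' \<subseteq> M p \<and> p $ 2 \<le> q $ 2))) \<or>
      (\<exists>t. z = Inr t \<and> vertex t \<and> M p' \<subseteq> M t \<and> t $ 2 < p' $ 2 \<and> leftmost g' t)"
      using \<open>R e' z\<close> unfolding R_def by blast
    have gg: "g = g'" using z z' leftmost_unique by (elim disjE exE conjE) auto
    have gM: "g \<in> M p" "g \<in> M p'" using p p' gg by (auto simp: leftmost_def)
    \<comment> \<open>With a common charge \<open>Inl g\<close>, each closed edge descends at least
      as low as any point of the region, in particular the sample point of the other edge. With a
      common charge \<open>Inr t\<close>, the shared vertex lies below both.\<close>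
    have "\<exists>t. M p' \<subseteq> M t \<and> t $ 2 \<le> p $ 2" "\<exists>t. M p \<subseteq> M t \<and> t $ 2 \<le> p' $ 2"
      using z z' gM gg less_imp_le by (elim disjE exE conjE; blast)+
    then show ?thesis
      using edge_eqI[of p p' g] edge_eqI[of p' p g] p p' gg linear[of "p $ 2" "p' $ 2"] by metis
  qed
  have "inj_on f (M ` Collect edge)"
    by (intro inj_onI) (metis f same)
  then have "card (M ` Collect edge) \<le> card (G <+> Collect vertex)"
    using f fin vertices_card(1) by (intro card_inj_on_le[of f]) auto
  then show ?thesis using card_Plus[OF fin vertices_card(1)] by simp
qed

text \<open>Writing G for the number of functions, there are at most 2G vertices, G + 2G edges, and
  G labels that are singletons; the sum is 6G.\<close>

lemma faces_card: "card (range M) \<le> 6 * card G"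
proof -
  have "p \<in> Collect vertex \<or> p \<in> Collect edge \<or> M p \<in> (\<lambda>g. {g}) ` G" for p
  proof (cases "\<exists>g\<in>M p. \<exists>h\<in>M p. g \<noteq> h")
    case False
    moreover obtain g where "g \<in> M p" using ex_leftmost[of p] unfolding leftmost_def by blast
    ultimately have "M p = {g}" "g \<in> G" using minimizersD by blast+
    then show ?thesis by blast
  qed (auto simp: edge_def)
  then have "range M \<subseteq> (M ` Collect vertex \<union> M ` Collect edge) \<union> (\<lambda>g. {g}) ` G" by blast
  moreover have "finite (range M)"
    by (rule finite_subset[of "range M" "Pow G"]) (use fin minimizersD(1) in blast)+
  then have "finite ((M ` Collect vertex \<union> M ` Collect edge) \<union> (\<lambda>g. {g}) ` G)"
    using fin by (simp add: finite_subset[OF image_mono[OF subset_UNIV]])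
  ultimately have "card (range M) \<le> card ((M ` Collect vertex \<union> M ` Collect edge) \<union> (\<lambda>g. {g}) ` G)"
    by (intro card_mono)
  also have "\<dots> \<le> (card (M ` Collect vertex) + card (M ` Collect edge)) + card ((\<lambda>g. {g}) ` G)"
    by (rule order_trans[OF card_Un_le add_right_mono[OF card_Un_le]])
  also have "\<dots> \<le> (card (Collect vertex) + (card G + card (Collect vertex))) + card G"
    using edges_card card_image_le[OF vertices_card(1)] card_image_le[OF fin]
    by (intro add_mono) auto
  finally show ?thesis using vertices_card(2) by linarith
qed

end

lemma minimizers_faces_card:
  fixes G :: "(real \<times> (real^2)) set"
  assumes "finite G" "G \<noteq> {}"
  shows "card (range (minimizers G)) \<le> 6 * card G"
proof -
  \<comment> \<open>The shear parameters that would give equal first entries to two gradients with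
    different second entries. Pairs with equal second entries merely contribute 0, the value of a
    division by zero.\<close>
  define bad where "bad = (\<lambda>(g, h). (snd h $ 1 - snd g $ 1) / (snd g $ 2 - snd h $ 2 :: real)) ` (G \<times> G)"
  have "finite bad" using assms by (simp add: bad_def)
  then obtain k where k: "k \<notin> bad" using ex_new_if_finite[OF infinite_UNIV_char_0] by blast
  \<comment> \<open>\<open>T\<close> shears the plane and \<open>S\<close> applies the adjoint shear
    to gradients, so that values are preserved.\<close>
  define T where "T p = (vector [p $ 1, p $ 2 + k * p $ 1] :: real^2)" for p :: "real^2"
  define S where "S g = (fst g, vector [snd g $ 1 + k * snd g $ 2, snd g $ 2] :: real^2)" for g :: "real \<times> (real^2)"
  have val: "affine_val (S g) p = affine_val g (T p)" for g p
    by (simp add: affine_val_def S_def T_def inner_real2 algebra_simps)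
  have injS: "inj S" by (auto simp: inj_def S_def prod_eq_iff eq_real2_iff)
  have surjT: "range T = UNIV"
  proof (intro equalityI subset_UNIV subsetI)
    fix q :: "real^2"
    have "q = T (vector [q $ 1, q $ 2 - k * q $ 1])" by (simp add: T_def eq_real2_iff)
    then show "q \<in> range T" by blast
  qed
  have min: "minimizers (S ` G) p = S ` minimizers G (T p)" for p
    by (auto simp: minimizers_def val)
  interpret sheared_family "S ` G"
  proof
    show "finite (S ` G)" "S ` G \<noteq> {}" using assms by auto
    fix g' h' assume "g' \<in> S ` G" "h' \<in> S ` G" and eq: "snd g' $ 1 = snd h' $ 1"
    then obtain g h where gh: "g \<in> G" "h \<in> G" "g' = S g" "h' = S h" by auto
    have eq': "snd g $ 1 + k * snd g $ 2 = snd h $ 1 + k * snd h $ 2" using eq gh by (simp add: S_def)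
    have "snd g $ 2 = snd h $ 2"
    proof (rule ccontr)
      assume "snd g $ 2 \<noteq> snd h $ 2"
      then have "k = (snd h $ 1 - snd g $ 1) / (snd g $ 2 - snd h $ 2)"
        using eq' by (simp add: field_simps)
      then show False using k gh by (force simp: bad_def)
    qed
    then show "snd g' = snd h'" using eq' gh by (simp add: S_def)
  qed
  have "range (minimizers (S ` G)) = (`) S ` range (minimizers G)"
    unfolding min using surjT by (metis image_image)
  then have "card (range (minimizers (S ` G))) = card (range (minimizers G))"
    by (simp add: card_image inj_on_def inj_image_eq_iff[OF injS])
  moreover have "card (S ` G) = card G" using injS by (simp add: card_image inj_on_subset[OF injS])
  ultimately show ?thesis using faces_card by simp
qed

section \<open>Reduction to functions minimal at generic points\<close>

lemma card_range_le_if_determined: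
  assumes "finite (range f)" "\<And>p q. f p = f q \<Longrightarrow> g p = g q"
  shows "card (range g) \<le> card (range f)"
proof -
  have "g p = g (inv f (f p))" for p
    using assms(2)[of p "inv f (f p)"] f_inv_into_f[of "f p" f UNIV] by simp
  then have "range g \<subseteq> (\<lambda>z. g (inv f z)) ` range f" by auto
  then show ?thesis using assms(1) by (meson surj_card_le)
qed

text \<open>A hyperplane is closed with empty interior, so deleting it from a nonempty open set
  leaves a nonempty open set. Hyperplanes are deleted one at a time.\<close>

lemma open_avoid_hyperplanes:
  fixes H :: "(real \<times> 'a::euclidean_space) set"
  assumes "finite H" "\<And>h. h \<in> H \<Longrightarrow> snd h \<noteq> 0" "open S" "S \<noteq> {}"
  shows "\<exists>q\<in>S. \<forall>h\<in>H. affine_val h q \<noteq> 0"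
  using assms
proof (induction H arbitrary: S)
  case empty
  then show ?case by auto
next
  case (insert h H)
  define Z where "Z = {q. snd h \<bullet> q = - fst h}"
  have Z: "affine_val h q = 0 \<longleftrightarrow> q \<in> Z" for q by (auto simp: Z_def affine_val_def)
  have "closed Z" by (auto simp: Z_def closed_hyperplane)
  moreover have "\<not> S \<subseteq> Z"
  proof
    assume "S \<subseteq> Z"
    then have "S \<subseteq> interior Z" using insert.prems by (simp add: interior_maximal)
    moreover have "interior Z = {}" using insert.prems(1)[of h] by (simp add: Z_def interior_hyperplane)
    ultimately show False using insert.prems by blast
  qed
  ultimately obtain q where "q \<in> S - Z" "\<forall>h\<in>H. affine_val h q \<noteq> 0"
    using insert.IH[of "S - Z"] insert.prems by (metis open_Diff insertCI Diff_eq_empty_iff)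
  then show ?case using Z by (intro bexI[of _ q]) auto
qed

text \<open>Points off the hyperplanes in \<open>H\<close> are dense, so the functions in \<open>U\<close> alone already realise the
  lower envelope and determine its faces.\<close>

lemma faces_card_generic:
  fixes T :: "(real \<times> (real^2)) set"
  assumes fin: "finite T" "T \<noteq> {}" and H: "finite H" "\<And>h. h \<in> H \<Longrightarrow> snd h \<noteq> 0"
  defines "U \<equiv> {g. \<exists>q. (\<forall>h\<in>H. affine_val h q \<noteq> 0) \<and> g \<in> minimizers T q}"
  shows "card (range (minimizers T)) \<le> 6 * card U"
proof -
  have UT: "U \<subseteq> T" by (auto simp: U_def minimizers_def)
  then have finU: "finite U" using fin finite_subset by blast
  \<comment> \<open>A generic point close to \<open>p\<close> has a minimizer, and this is still
    minimal at \<open>p\<close>.\<close>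
  have meet: "\<exists>g\<in>U. g \<in> minimizers T p" for p
  proof -
    obtain S where S: "open S" "p \<in> S" "\<And>q. q \<in> S \<Longrightarrow> minimizers T q \<subseteq> minimizers T p"
      using minimizers_locally_subset[OF fin(1), of p] by metis
    obtain q where q: "q \<in> S" "\<forall>h\<in>H. affine_val h q \<noteq> 0"
      using open_avoid_hyperplanes[OF H S(1)] S(2) by blast
    obtain g where "g \<in> minimizers T q" using minimizers_nonempty[OF fin, of q] by blast
    then show ?thesis using q S(3)[OF q(1)] unfolding U_def by blast
  qed
  have minU: "minimizers U p = minimizers T p \<inter> U" for p
  proof -
    obtain g where g: "g \<in> U" "g \<in> minimizers T p" using meet by blast
    show ?thesis
    proof (intro equalityI subsetI)
      fix h assume h: "h \<in> minimizers U p"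
      then have "h \<in> U" "affine_val h p \<le> affine_val g p" using g(1) minimizersD[of h U p] by auto
      moreover have "affine_val g p \<le> affine_val h p"
        using g(2) \<open>h \<in> U\<close> UT minimizersD(2)[of g T p h] by blast
      ultimately show "h \<in> minimizers T p \<inter> U"
        using minimizersI_eq[OF g(2), of h] UT by auto
    next
      fix h assume "h \<in> minimizers T p \<inter> U"
      then show "h \<in> minimizers U p" using UT by (auto simp: minimizers_def)
    qed
  qed
  \<comment> \<open>The \<open>U\<close>-label stays constant slightly beyond \<open>p\<close> on
    the side away from \<open>q\<close>. There \<open>g\<close> is at most \<open>h\<close>, and
    they tie at \<open>p\<close>, so \<open>h\<close> grows no faster than \<open>g\<close> towards
    \<open>q\<close>.\<close>
  have sub: "minimizers T p \<subseteq> minimizers T q" if eq: "minimizers U p = minimizers U q" for p q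
  proof
    fix h assume h: "h \<in> minimizers T p"
    obtain g where g: "g \<in> minimizers U p" "g \<in> minimizers T p" "g \<in> minimizers T q"
      using meet[of p] minU[of p] minU[of q] eq by blast
    have "snd k \<bullet> (q - p) = snd k' \<bullet> (q - p)" if "k \<in> minimizers U p" "k' \<in> minimizers U p" for k k'
      using that eq minimizers_eq[of k U p k'] minimizers_eq[of k U q k'] affine_val_agree by blast
    then obtain e where e: "e > 0" "\<And>s. \<bar>s\<bar> \<le> e \<Longrightarrow> minimizers U (p + s *\<^sub>R (q - p)) = minimizers U p"
      using minimizers_locally_constant[OF finU, of p "q - p"] by blast
    have "g \<in> minimizers U (p + (- e) *\<^sub>R (q - p))" using e(2)[of "- e"] e(1) g(1) by simp
    then have "affine_val g (p + (- e) *\<^sub>R (q - p)) \<le> affine_val h (p + (- e) *\<^sub>R (q - p))"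
      using minU minimizersD h by blast
    then have "e * (snd h \<bullet> (q - p)) \<le> e * (snd g \<bullet> (q - p))"
      unfolding affine_val_line using minimizers_eq[OF g(2) h] by simp
    then have "snd h \<bullet> (q - p) \<le> snd g \<bullet> (q - p)" using e(1) by simp
    then have "affine_val h q \<le> affine_val g q"
      using affine_val_diff[of g q p] affine_val_diff[of h q p] minimizers_eq[OF g(2) h] by linarith
    then show "h \<in> minimizers T q"
      using minimizersI_eq[OF g(3)] minimizersD(1)[OF h] minimizersD(2)[OF g(3) minimizersD(1)[OF h]]
      by (simp add: antisym)
  qed
  have "U \<noteq> {}" using meet by blast
  have "finite (range (minimizers U))"
    by (rule finite_subset[of _ "Pow U"]) (use finU minimizersD(1) in blast)+
  moreover have "minimizers T p = minimizers T q" if "minimizers U p = minimizers U q" for p q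
    using sub[OF that] sub[OF that[symmetric]] by blast
  ultimately have "card (range (minimizers T)) \<le> card (range (minimizers U))"
    by (rule card_range_le_if_determined)
  also have "\<dots> \<le> 6 * card U" by (rule minimizers_faces_card[OF finU \<open>U \<noteq> {}\<close>])
  finally show ?thesis .
qed

section \<open>Arrangements of lines and unions of chains\<close>

text \<open>Each open cell of the arrangement that meets \<open>V\<close> is encoded by the indices
  of the functions positive on it. The parameter \<open>V\<close> lets an induction restrict the
  arrangement to one of its lines.\<close>

definition sign_patterns :: "('i \<Rightarrow> real \<times> 'a::euclidean_space) \<Rightarrow> 'a set \<Rightarrow> 'i set \<Rightarrow> 'i set set" where
  "sign_patterns F V I =
     (\<lambda>t. {i \<in> I. affine_val (F i) t > 0}) ` {t \<in> V. \<forall>i\<in>I. affine_val (F i) t \<noteq> 0}"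

lemma finite_sign_patterns: "finite I \<Longrightarrow> finite (sign_patterns F V I)"
  by (rule finite_subset[of _ "Pow I"]) (auto simp: sign_patterns_def)

text \<open>Deletion and restriction: a pattern splits in two only if it occurs on both sides of the
  zero set of \<open>F j\<close>. The segment joining two such points then crosses that zero set
  with the same pattern.\<close>

lemma card_sign_patterns_insert:
  assumes "convex V" "finite I" "j \<notin> I"
  shows "card (sign_patterns F V (insert j I))
    \<le> card (sign_patterns F V I) + card (sign_patterns F (V \<inter> {t. affine_val (F j) t = 0}) I)"
proof -
  define P where "P = sign_patterns F (V \<inter> {t. affine_val (F j) t > 0}) I"
  define N where "N = sign_patterns F (V \<inter> {t. affine_val (F j) t < 0}) I"
  have fin: "finite P" "finite N" using assms by (simp_all add: P_def N_def finite_sign_patterns)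
  have "sign_patterns F V (insert j I) \<subseteq> insert j ` P \<union> N"
  proof
    fix X assume "X \<in> sign_patterns F V (insert j I)"
    then obtain t where t: "t \<in> V" "\<forall>i\<in>insert j I. affine_val (F i) t \<noteq> 0"
      "X = {i \<in> insert j I. affine_val (F i) t > 0}" by (auto simp: sign_patterns_def)
    define Y where "Y = {i \<in> I. affine_val (F i) t > 0}"
    show "X \<in> insert j ` P \<union> N"
    proof (cases "affine_val (F j) t > 0")
      case True
      then have "X = insert j Y" using t by (auto simp: Y_def)
      moreover have "Y \<in> P" unfolding P_def sign_patterns_def Y_def using t True by auto
      ultimately show ?thesis by blast
    next
      case False
      then have "X = Y" using t by (auto simp: Y_def)
      moreover have "affine_val (F j) t < 0" using t(2) False by force
      then have "Y \<in> N" unfolding N_def sign_patterns_def Y_def using t by auto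
      ultimately show ?thesis by blast
    qed
  qed
  then have "card (sign_patterns F V (insert j I)) \<le> card (insert j ` P \<union> N)"
    using fin by (intro card_mono) auto
  also have "\<dots> \<le> card P + card N"
    using card_Un_le[of "insert j ` P" N] card_image_le[OF fin(1), of "insert j"] by linarith
  also have "\<dots> = card (P \<union> N) + card (P \<inter> N)" using fin by (rule card_Un_Int)
  also have "\<dots> \<le> card (sign_patterns F V I) + card (sign_patterns F (V \<inter> {t. affine_val (F j) t = 0}) I)"
  proof (intro add_mono card_mono finite_sign_patterns assms)
    show "P \<union> N \<subseteq> sign_patterns F V I" by (auto simp: P_def N_def sign_patterns_def)
    show "P \<inter> N \<subseteq> sign_patterns F (V \<inter> {t. affine_val (F j) t = 0}) I"
    proof
      fix X assume "X \<in> P \<inter> N"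
      then obtain t u where t: "t \<in> V" "affine_val (F j) t > 0" "\<forall>i\<in>I. affine_val (F i) t \<noteq> 0"
          "X = {i \<in> I. affine_val (F i) t > 0}"
        and u: "u \<in> V" "affine_val (F j) u < 0" "\<forall>i\<in>I. affine_val (F i) u \<noteq> 0"
          "X = {i \<in> I. affine_val (F i) u > 0}"
        by (auto simp: P_def N_def sign_patterns_def)
      \<comment> \<open>The parameter at which \<open>F j\<close> vanishes on the segment from
        \<open>t\<close> to \<open>u\<close>.\<close>
      define a where "a = affine_val (F j) t / (affine_val (F j) t - affine_val (F j) u)"
      have a: "0 < a" "a < 1" using t u by (auto simp: a_def divide_simps)
      define w where "w = (1 - a) *\<^sub>R t + a *\<^sub>R u"
      have val: "affine_val g w = (1 - a) * affine_val g t + a * affine_val g u" for g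
        by (simp add: affine_val_def w_def inner_simps algebra_simps)
      have "w \<in> V" unfolding w_def using assms(1) t u a by (intro convexD) auto
      moreover have "affine_val (F j) w = 0" unfolding val using t u by (simp add: a_def field_simps)
      moreover have sgn: "affine_val (F i) w \<noteq> 0 \<and> (affine_val (F i) w > 0 \<longleftrightarrow> affine_val (F i) t > 0)"
        if "i \<in> I" for i
      proof (cases "affine_val (F i) t > 0")
        case True
        then have "affine_val (F i) u > 0" using that t(4) u(4) by blast
        then have "affine_val (F i) w > 0" unfolding val using a True by (simp add: add_pos_pos)
        then show ?thesis using True by simp
      next
        case False
        then have "\<not> affine_val (F i) u > 0" using that t(4) u(4) by blast
        then have "affine_val (F i) u < 0" "affine_val (F i) t < 0" using False that t(3) u(3) by force+
        then have "affine_val (F i) w < 0"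
          unfolding val using a by (intro add_neg_neg) (auto simp: mult_less_0_iff)
        then show ?thesis using False by simp
      qed
      moreover have "X = {i \<in> I. affine_val (F i) w > 0}" using sgn t(4) by auto
      ultimately show "X \<in> sign_patterns F (V \<inter> {t. affine_val (F j) t = 0}) I"
        unfolding sign_patterns_def by (intro image_eqI[of _ _ w]) auto
    qed
  qed
  finally show ?thesis .
qed

text \<open>The assumption makes \<open>V\<close> behave like a line. A function vanishing on all of
  \<open>V\<close> leaves no pattern, and any other cuts \<open>V\<close> in at most one point,
  adding at most one pattern.\<close>

lemma card_sign_patterns_line:
  assumes "finite I" "convex V"
    and "\<And>i. i \<in> I \<Longrightarrow> V \<subseteq> {t. affine_val (F i) t = 0} \<or>
      (\<forall>x\<in>V. \<forall>y\<in>V. affine_val (F i) x = 0 \<longrightarrow> affine_val (F i) y = 0 \<longrightarrow> x = y)"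
  shows "card (sign_patterns F V I) \<le> card I + 1"
  using assms
proof (induction I)
  case empty
  have "sign_patterns F V {} \<subseteq> {{}}" by (auto simp: sign_patterns_def)
  then show ?case using card_mono[of "{{}}" "sign_patterns F V {}"] by simp
next
  case (insert j I)
  show ?case
  proof (cases "V \<subseteq> {t. affine_val (F j) t = 0}")
    case True
    then have "sign_patterns F V (insert j I) = {}" by (auto simp: sign_patterns_def)
    then show ?thesis by simp
  next
    case False
    define Z where "Z = V \<inter> {t. affine_val (F j) t = 0}"
    have "x = y" if "x \<in> Z" "y \<in> Z" for x y using insert.prems(2)[of j] False that by (auto simp: Z_def)
    then have "Z = {} \<or> (\<exists>x. Z = {x})" by blast
    then obtain x where "Z \<subseteq> {x}" by blast
    then have "sign_patterns F Z I \<subseteq> {{i \<in> I. affine_val (F i) x > 0}}" by (auto simp: sign_patterns_def)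
    then have "card (sign_patterns F Z I) \<le> 1"
      using card_mono[of "{{i \<in> I. affine_val (F i) x > 0}}" "sign_patterns F Z I"] by simp
    moreover have "card (sign_patterns F V I) \<le> card I + 1"
      by (rule insert.IH) (use insert.prems in auto)
    ultimately show ?thesis
      using card_sign_patterns_insert[OF insert.prems(1) insert.hyps, of F] insert.hyps
      by (simp add: Z_def)
  qed
qed

text \<open>With k lines present, they cut a new line into at most k + 1 pieces, each adding at most
  one cell.\<close>

lemma card_sign_patterns_plane:
  fixes F :: "'i \<Rightarrow> real \<times> (real^2)"
  assumes "finite I" "\<And>i. i \<in> I \<Longrightarrow> snd (F i) \<noteq> 0"
  shows "card (sign_patterns F UNIV I) \<le> (card I + 1)\<^sup>2"
  using assms
proof (induction I)
  case empty
  have "sign_patterns F UNIV {} \<subseteq> {{}}" by (auto simp: sign_patterns_def)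
  then show ?case using card_mono[of "{{}}" "sign_patterns F UNIV {}"] by simp
next
  case (insert j I)
  define Z where "Z = {t. affine_val (F j) t = 0}"
  have "Z = {t. snd (F j) \<bullet> t = - fst (F j)}" by (auto simp: Z_def affine_val_def)
  then have "convex Z" by (simp add: convex_hyperplane)
  then have "card (sign_patterns F Z I) \<le> card I + 1"
  proof (rule card_sign_patterns_line[OF insert.hyps(1)])
    fix i assume "i \<in> I"
    show "Z \<subseteq> {t. affine_val (F i) t = 0} \<or>
      (\<forall>x\<in>Z. \<forall>y\<in>Z. affine_val (F i) x = 0 \<longrightarrow> affine_val (F i) y = 0 \<longrightarrow> x = y)"
    proof (rule disjCI, rule subsetI)
      fix z assume z: "z \<in> Z"
      assume "\<not> (\<forall>x\<in>Z. \<forall>y\<in>Z. affine_val (F i) x = 0 \<longrightarrow> affine_val (F i) y = 0 \<longrightarrow> x = y)"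
      then obtain x y where xy: "x \<in> Z" "y \<in> Z" "affine_val (F i) x = 0" "affine_val (F i) y = 0" "x \<noteq> y"
        by blast
      \<comment> \<open>Two lines with two common points coincide: \<open>u\<close> and
        \<open>w\<close> are orthogonal to \<open>d\<close>, hence parallel, so \<open>e\<close> is
        orthogonal to \<open>w\<close> because it is to \<open>u\<close>.\<close>
      define u w d e where "u = y - x" and "w = z - x" and "d = snd (F j)" and "e = snd (F i)"
      have du: "d \<bullet> u = 0" "d \<bullet> w = 0" "e \<bullet> u = 0"
        using z xy affine_val_diff[of "F j" y x] affine_val_diff[of "F j" z x] affine_val_diff[of "F i" y x]
        by (auto simp: u_def w_def d_def e_def Z_def)
      have "d \<noteq> 0" using insert.prems by (simp add: d_def)
      have "u \<noteq> 0" using xy by (simp add: u_def)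
      have 1: "d $ 1 * u $ 1 = - (d $ 2 * u $ 2)" "d $ 1 * w $ 1 = - (d $ 2 * w $ 2)"
        using du by (auto simp: inner_real2)
      have "d $ 1 * (u $ 1 * w $ 2 - u $ 2 * w $ 1) = (d $ 1 * u $ 1) * w $ 2 - u $ 2 * (d $ 1 * w $ 1)"
        by (simp add: algebra_simps)
      also have "\<dots> = 0" unfolding 1 by simp
      finally have A: "d $ 1 * (u $ 1 * w $ 2 - u $ 2 * w $ 1) = 0" .
      have 2: "d $ 2 * u $ 2 = - (d $ 1 * u $ 1)" "d $ 2 * w $ 2 = - (d $ 1 * w $ 1)"
        using 1 by auto
      have "d $ 2 * (u $ 1 * w $ 2 - u $ 2 * w $ 1) = u $ 1 * (d $ 2 * w $ 2) - (d $ 2 * u $ 2) * w $ 1"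
        by (simp add: algebra_simps)
      also have "\<dots> = 0" unfolding 2 by simp
      finally have cr: "u $ 1 * w $ 2 = u $ 2 * w $ 1"
        using A \<open>d \<noteq> 0\<close> by (auto simp: eq_real2_iff)
      have "u $ 1 * (e \<bullet> w) = w $ 1 * (e \<bullet> u)" "u $ 2 * (e \<bullet> w) = w $ 2 * (e \<bullet> u)"
        using cr by (simp_all add: inner_real2 algebra_simps)
      then have "e \<bullet> w = 0" using du(3) \<open>u \<noteq> 0\<close> by (auto simp: eq_real2_iff)
      then show "z \<in> {t. affine_val (F i) t = 0}"
        using affine_val_diff[of "F i" z x] xy by (simp add: e_def w_def)
    qed
  qed
  moreover have "card (sign_patterns F UNIV I) \<le> (card I + 1)\<^sup>2"
    by (rule insert.IH) (use insert.prems in auto)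
  moreover have "card (sign_patterns F UNIV (insert j I)) \<le> card (sign_patterns F UNIV I) + card (sign_patterns F Z I)"
    using card_sign_patterns_insert[OF convex_UNIV insert.hyps, of F] by (simp add: Z_def)
  ultimately show ?case using insert.hyps by (simp add: power2_eq_square)
qed

section \<open>Unions of chain members\<close>

definition chain_unions :: "('b \<Rightarrow> 'a set set) \<Rightarrow> 'b set \<Rightarrow> nat \<Rightarrow> 'a set set" where
  "chain_unions C B s =
     {S. finite S \<and> card S = s \<and> (\<exists>N. (\<forall>b\<in>B. N b \<in> C b) \<and> S = (\<Union>b\<in>B. N b))}"

text \<open>Adding the chains one at a time, a union is determined by how many new elements each chain contributes.\<close>

lemma card_chain_unions:
  assumes "finite B" and chain: "\<And>b X Y. X \<in> C b \<Longrightarrow> Y \<in> C b \<Longrightarrow> X \<subseteq> Y \<or> Y \<subseteq> X"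
  shows "finite (chain_unions C B s) \<and> card (chain_unions C B s) \<le> 2 ^ (card B + s)"
  using assms(1)
proof (induction B arbitrary: s)
  case empty
  have "chain_unions C {} s \<subseteq> {{}}" by (auto simp: chain_unions_def)
  then have "finite (chain_unions C {} s)" "card (chain_unions C {} s) \<le> 1"
    using card_mono[of "{{}}" "chain_unions C {} s"] finite_subset[of "chain_unions C {} s" "{{}}"] by simp_all
  then show ?case using one_le_power[of "2::nat" s] by (auto intro: order_trans)
next
  case (insert b B)
  define W where "W = (\<Union>j\<le>s. chain_unions C B j)"
  have finW: "finite W" using insert.IH by (auto simp: W_def)
  have "\<exists>S'\<in>W. \<exists>X\<in>C b. S = S' \<union> X" if S: "S \<in> chain_unions C (insert b B) s" for S
  proof -
    obtain N where N: "\<forall>b\<in>insert b B. N b \<in> C b" "S = (\<Union>b\<in>insert b B. N b)"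
      using S by (auto simp: chain_unions_def)
    have "finite S" "card S = s" using S by (auto simp: chain_unions_def)
    define S' where "S' = (\<Union>b\<in>B. N b)"
    have "S' \<subseteq> S" using N by (auto simp: S'_def)
    then have "finite S'" "card S' \<le> s"
      using \<open>finite S\<close> \<open>card S = s\<close> finite_subset card_mono by blast+
    then have "S' \<in> W" using N by (auto simp: W_def chain_unions_def S'_def)
    then show ?thesis using N by (intro bexI[of _ S'] bexI[of _ "N b"]) (auto simp: S'_def)
  qed
  then obtain f where f: "\<And>S. S \<in> chain_unions C (insert b B) s \<Longrightarrow> f S \<in> W \<and> (\<exists>X\<in>C b. S = f S \<union> X)"
    by metis
  \<comment> \<open>Sets with the same partial union \<open>K\<close> are comparable because
    \<open>X\<close> and \<open>Y\<close> are; equal size then makes them equal.\<close>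
  have "inj_on f (chain_unions C (insert b B) s)"
  proof (rule inj_onI)
    fix S T assume S: "S \<in> chain_unions C (insert b B) s" and T: "T \<in> chain_unions C (insert b B) s"
      and eq: "f S = f T"
    obtain X Y where XY: "X \<in> C b" "S = f S \<union> X" "Y \<in> C b" "T = f T \<union> Y"
      using f[OF S] f[OF T] by metis
    obtain K where "S = K \<union> X" "T = K \<union> Y" using XY eq by metis
    then have "S \<subseteq> T \<or> T \<subseteq> S" using chain[OF XY(1,3)] by blast
    moreover have "finite S" "finite T" "card S = card T" using S T by (simp_all add: chain_unions_def)
    ultimately show "S = T" using card_subset_eq[of S T] card_subset_eq[of T S] by auto
  qed
  moreover have "f ` chain_unions C (insert b B) s \<subseteq> W" using f by blast
  ultimately have fin: "finite (chain_unions C (insert b B) s)"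
    and "card (chain_unions C (insert b B) s) \<le> card W"
    using finW by (rule inj_on_finite, rule card_inj_on_le)
  note this(2)
  also have "card W \<le> (\<Sum>j\<le>s. card (chain_unions C B j))"
    unfolding W_def by (rule card_UN_le) simp
  also have "\<dots> \<le> (\<Sum>j\<le>s. 2 ^ (card B + j))" using insert.IH by (intro sum_mono) blast
  also have "\<dots> = 2 ^ card B * (\<Sum>j\<le>s. 2 ^ j)" by (simp add: power_add sum_distrib_left)
  also have "(\<Sum>j\<le>s. 2 ^ j) \<le> (2::nat) ^ Suc s" by (induction s) auto
  finally have "card (chain_unions C (insert b B) s) \<le> 2 ^ card B * 2 ^ Suc s" by simp
  then show ?case using fin insert.hyps by (simp add: power_add)
qed

section \<open>Nearest neighbours\<close>

text \<open>Up to the common term \<open>p \<bullet> p\<close> this is the squared distance from \<open>p\<close> to \<open>a\<close>.\<close>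

definition voronoi :: "real^2 \<Rightarrow> real \<times> (real^2)" where
  "voronoi a = (a \<bullet> a, (- 2) *\<^sub>R a)"

lemma dist_voronoi: "(dist p a)\<^sup>2 = p \<bullet> p + affine_val (voronoi a) p"
  by (simp add: dist_norm power2_norm_eq_inner affine_val_def voronoi_def inner_simps inner_commute)

lemma dist_le_voronoi: "dist p a \<le> dist p b \<longleftrightarrow> affine_val (voronoi a) p \<le> affine_val (voronoi b) p"
proof -
  have "dist p a \<le> dist p b \<longleftrightarrow> (dist p a)\<^sup>2 \<le> (dist p b)\<^sup>2" by simp
  then show ?thesis by (simp only: dist_voronoi add_le_cancel_left)
qed

lemma dist_less_voronoi: "dist p a < dist p b \<longleftrightarrow> affine_val (voronoi a) p < affine_val (voronoi b) p"
  using dist_le_voronoi[of p b a] by linarith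

lemma dist_eq_voronoi: "dist p a = dist p b \<longleftrightarrow> affine_val (voronoi a) p = affine_val (voronoi b) p"
  using dist_le_voronoi[of p b a] dist_le_voronoi[of p a b] by linarith

lemma inj_voronoi: "inj voronoi"
  by (simp add: inj_def voronoi_def)

text \<open>Both orders of the pairs whose bisector carries an edge of a Voronoi diagram of order at
  most \<open>m\<close>.\<close>

definition close_pairs :: "(real^2) set \<Rightarrow> nat \<Rightarrow> ((real^2) \<times> (real^2)) set" where
  "close_pairs A m = {(a, b). a \<in> A \<and> b \<in> A \<and> a \<noteq> b \<and>
     (\<exists>p. dist p a = dist p b \<and> (\<forall>x\<in>A. dist p x = dist p a \<longrightarrow> x = a \<or> x = b) \<and>
          card {x \<in> A. dist p x < dist p a} < m)}"

lemma close_pairs_subset: "close_pairs A m \<subseteq> A \<times> A"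
  by (auto simp: close_pairs_def)

text \<open>Clarkson--Shor sampling: a close pair becomes an edge of the Voronoi diagram of a uniformly random
  subset of \<open>A\<close> with probability at least \<open>1 / 2 ^ (m + 1)\<close>, and a Voronoi diagram has linearly many edges.\<close>

lemma card_close_pairs:
  assumes "finite A"
  shows "card (close_pairs A m) \<le> 48 * card A * 2 ^ m"
proof -
  define E where "E = (\<lambda>(a, b). {a, b}) ` close_pairs A m"
  \<comment> \<open>The pair \<open>e\<close> is the label of a face in the Voronoi diagram of the
    sample \<open>X\<close>, seen as a lower envelope.\<close>
  define R where "R e X \<longleftrightarrow> e \<subseteq> X \<and> voronoi ` e \<in> range (minimizers (voronoi ` X))" for e X
  have finC: "finite (close_pairs A m)" using close_pairs_subset assms finite_subset by blast
  then have finE: "finite E" by (simp add: E_def)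
  have lower: "2 ^ card A \<le> 2 ^ (m + 1) * card {X \<in> Pow A. R e X}" if "e \<in> E" for e
  proof -
    obtain a b where ab: "(a, b) \<in> close_pairs A m" "e = {a, b}" using \<open>e \<in> E\<close> by (auto simp: E_def)
    then obtain p where p: "a \<in> A" "b \<in> A" "a \<noteq> b" "dist p a = dist p b"
      "\<And>x. x \<in> A \<Longrightarrow> dist p x = dist p a \<Longrightarrow> x = a \<or> x = b"
      "card {x \<in> A. dist p x < dist p a} < m"
      by (auto simp: close_pairs_def)
    define D where "D = {x \<in> A. dist p x < dist p a}"
    have R: "R e X" if X: "e \<subseteq> X" "X \<subseteq> A - D" for X
    proof -
      have "minimizers (voronoi ` X) p = voronoi ` e"
      proof (intro equalityI subsetI)
        fix g assume "g \<in> minimizers (voronoi ` X) p"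
        then obtain x where x: "x \<in> X" "g = voronoi x" and "affine_val g p \<le> affine_val (voronoi a) p"
          using X ab minimizersD[of g "voronoi ` X" p] by blast
        then have "dist p x \<le> dist p a" by (simp add: dist_le_voronoi)
        moreover have "\<not> dist p x < dist p a" using X x by (auto simp: D_def)
        ultimately have "x = a \<or> x = b" using p(5)[of x] X x by auto
        then show "g \<in> voronoi ` e" using x ab by auto
      next
        fix g assume "g \<in> voronoi ` e"
        then obtain x where x: "x = a \<or> x = b" "g = voronoi x" using ab by auto
        have "dist p x \<le> dist p y" if "y \<in> X" for y
        proof -
          have "\<not> dist p y < dist p a" using X that by (auto simp: D_def)
          then show ?thesis using x p(4) by auto
        qed
        moreover have "x \<in> X" using X x ab by auto
        ultimately show "g \<in> minimizers (voronoi ` X) p"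
          using x(2) by (auto simp: minimizers_def dist_le_voronoi)
      qed
      then show ?thesis using X(1) unfolding R_def by (metis rangeI)
    qed
    have De: "D \<inter> e = {}" "D \<subseteq> A" "e \<subseteq> A" using p ab by (auto simp: D_def)
    define F where "F = A - e - D"
    have cardA: "card A = card F + (card D + 2)"
    proof -
      have "A = F \<union> (D \<union> e)" "F \<inter> (D \<union> e) = {}" using De by (auto simp: F_def)
      moreover have "card (D \<union> e) = card D + 2"
        using De assms p(3) ab finite_subset by (subst card_Un_disjoint) auto
      ultimately show ?thesis
        using assms by (metis card_Un_disjoint finite_Un)
    qed
    have "inj_on (\<lambda>Y. e \<union> Y) (Pow F)" by (auto simp: inj_on_def F_def)
    then have "card ((\<lambda>Y. e \<union> Y) ` Pow F) = 2 ^ card F"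
      using assms by (simp add: card_image card_Pow F_def)
    moreover have "(\<lambda>Y. e \<union> Y) ` Pow F \<subseteq> {X \<in> Pow A. R e X}"
    proof
      fix X assume "X \<in> (\<lambda>Y. e \<union> Y) ` Pow F"
      then have "e \<subseteq> X" "X \<subseteq> A - D" using De by (auto simp: F_def)
      then show "X \<in> {X \<in> Pow A. R e X}" using R by auto
    qed
    ultimately have "2 ^ card F \<le> card {X \<in> Pow A. R e X}"
      using assms card_mono[of "{X \<in> Pow A. R e X}" "(\<lambda>Y. e \<union> Y) ` Pow F"] by simp
    \<comment> \<open>Samples must contain the two points of \<open>e\<close> and avoid
      \<open>D\<close>. This fixes \<open>card D + 2\<close> memberships, at most
      \<open>m + 1\<close> since \<open>card D < m\<close>.\<close>
    moreover have "(2::nat) ^ card A \<le> 2 ^ (m + 1 + card F)"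
      using p(6) cardA unfolding D_def[symmetric] by (intro power_increasing) auto
    ultimately show ?thesis
      unfolding power_add[of 2 "m + 1" "card F"] by (meson mult_le_mono2 order_trans)
  qed
  have upper: "card {e \<in> E. R e X} \<le> 6 * card A" if X: "X \<in> Pow A" for X
  proof (cases "X = {}")
    case True
    have "\<not> R e X" if "e \<in> E" for e using that True by (auto simp: R_def E_def)
    then have "{e \<in> E. R e X} = {}" by blast
    then show ?thesis by (simp only: card.empty)
  next
    case False
    have finX: "finite X" using X assms finite_subset by blast
    have inj: "inj_on ((`) voronoi) {e \<in> E. R e X}"
      by (simp add: inj_on_def inj_image_eq_iff[OF inj_voronoi])
    have finr: "finite (range (minimizers (voronoi ` X)))"
      by (rule finite_subset[of _ "Pow (voronoi ` X)"]) (use finX minimizersD(1) in blast)+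
    have "card {e \<in> E. R e X} \<le> card (range (minimizers (voronoi ` X)))"
      by (rule card_inj_on_le[OF inj _ finr]) (auto simp: R_def)
    also have "\<dots> \<le> 6 * card (voronoi ` X)" using finX False by (intro minimizers_faces_card) auto
    also have "\<dots> \<le> 6 * card A"
      using card_image_le[OF finX, of voronoi] card_mono[OF assms, of X] X by simp
    finally show ?thesis .
  qed
  \<comment> \<open>Double counting of the pairs of an \<open>e\<close> in \<open>E\<close> and a
    sample in which it appears.\<close>
  have "card E * 2 ^ card A = (\<Sum>e\<in>E. 2 ^ card A)" by simp
  also have "\<dots> \<le> (\<Sum>e\<in>E. 2 ^ (m + 1) * card {X \<in> Pow A. R e X})" using lower by (rule sum_mono)
  also have "\<dots> = 2 ^ (m + 1) * (\<Sum>e\<in>E. card {X \<in> Pow A. R e X})" by (simp add: sum_distrib_left)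
  also have "(\<Sum>e\<in>E. card {X \<in> Pow A. R e X}) = (\<Sum>X\<in>Pow A. card {e \<in> E. R e X})"
    using finE assms by (intro sum_multicount_gen) auto
  also have "\<dots> \<le> (\<Sum>X\<in>Pow A. 6 * card A)" using upper by (rule sum_mono)
  also have "\<dots> = 6 * card A * 2 ^ card A" using assms by (simp add: card_Pow)
  finally have "card E * 2 ^ card A \<le> (2 ^ (m + 1) * (6 * card A)) * 2 ^ card A" by (simp add: mult.assoc)
  then have E: "card E \<le> 12 * card A * 2 ^ m" by (simp add: mult_ac)
  \<comment> \<open>Passing back to ordered pairs costs the crude factor 4 for
    \<open>e \<times> e\<close>, which turns 12 into 48.\<close>
  have "close_pairs A m \<subseteq> (\<Union>e\<in>E. e \<times> e)" by (force simp: E_def)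
  moreover have e2: "finite e" "card e \<le> 2" if "e \<in> E" for e
    using that by (auto simp: E_def card_insert_if)
  then have "finite (\<Union>e\<in>E. e \<times> e)" using finE by simp
  ultimately have "card (close_pairs A m) \<le> card (\<Union>e\<in>E. e \<times> e)" by (intro card_mono)
  also have "\<dots> \<le> (\<Sum>e\<in>E. card (e \<times> e))" by (rule card_UN_le[OF finE])
  also have "\<dots> \<le> (\<Sum>e\<in>E. 4)"
    using mult_le_mono[OF e2(2) e2(2)] by (intro sum_mono) (simp add: card_cartesian_product)
  finally show ?thesis using E by simp
qed

text \<open>With two centres, \<open>b - a\<close> and \<open>c - a\<close> are both orthogonal to
  \<open>q - q'\<close>, hence parallel. But a line through \<open>a\<close> meets a circle through
  \<open>a\<close> in at most one further point, so \<open>b = c\<close>.\<close>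

lemma circumcenter_unique:
  fixes a b c q q' :: "real^2"
  assumes "a \<noteq> b" "a \<noteq> c" "b \<noteq> c"
    and q: "dist q a = dist q b" "dist q a = dist q c" and q': "dist q' a = dist q' b" "dist q' a = dist q' c"
  shows "q = q'"
proof (rule ccontr)
  assume "q \<noteq> q'"
  define w u v s where "w = q - q'" and "u = b - a" and "v = c - a" and "s = q - a"
  have "w \<noteq> 0" "u \<noteq> 0" "v \<noteq> 0" using assms \<open>q \<noteq> q'\<close> by (auto simp: w_def u_def v_def)
  have uw: "u \<bullet> w = 0" "v \<bullet> w = 0"
    using q q' by (simp_all add: dist_eq_voronoi affine_val_def voronoi_def u_def v_def w_def inner_simps)
  have us: "u \<bullet> u = 2 * (u \<bullet> s)" "v \<bullet> v = 2 * (v \<bullet> s)"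
    using q by (simp_all add: dist_eq_voronoi affine_val_def voronoi_def u_def v_def s_def inner_simps inner_commute)
  have 1: "u $ 1 * w $ 1 = - (u $ 2 * w $ 2)" "v $ 1 * w $ 1 = - (v $ 2 * w $ 2)"
    using uw by (auto simp: inner_real2)
  have "(u $ 1 * v $ 2 - u $ 2 * v $ 1) * w $ 1 = v $ 2 * (u $ 1 * w $ 1) - u $ 2 * (v $ 1 * w $ 1)"
    by (simp add: algebra_simps)
  also have "\<dots> = 0" unfolding 1 by simp
  finally have A: "(u $ 1 * v $ 2 - u $ 2 * v $ 1) * w $ 1 = 0" .
  have 2: "u $ 2 * w $ 2 = - (u $ 1 * w $ 1)" "v $ 2 * w $ 2 = - (v $ 1 * w $ 1)" using 1 by auto
  have "(u $ 1 * v $ 2 - u $ 2 * v $ 1) * w $ 2 = u $ 1 * (v $ 2 * w $ 2) - v $ 1 * (u $ 2 * w $ 2)"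
    by (simp add: algebra_simps)
  also have "\<dots> = 0" unfolding 2 by simp
  finally have cr: "u $ 1 * v $ 2 = u $ 2 * v $ 1" using A \<open>w \<noteq> 0\<close> by (auto simp: eq_real2_iff)
  have par: "u $ 1 * (v \<bullet> z) = v $ 1 * (u \<bullet> z)" "u $ 2 * (v \<bullet> z) = v $ 2 * (u \<bullet> z)" for z
    using cr by (simp_all add: inner_real2 algebra_simps)
  have "u $ 1 * (v \<bullet> v) = v $ 1 * (u \<bullet> u)" "u $ 2 * (v \<bullet> v) = v $ 2 * (u \<bullet> u)"
    using par[of s] us by simp_all
  then have "v $ 1 * (u \<bullet> v) = v $ 1 * (u \<bullet> u)" "v $ 2 * (u \<bullet> v) = v $ 2 * (u \<bullet> u)"
    "u $ 1 * (v \<bullet> v) = u $ 1 * (v \<bullet> u)" "u $ 2 * (v \<bullet> v) = u $ 2 * (v \<bullet> u)"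
    using par[of v] par[of u] by simp_all
  then have "u \<bullet> v = u \<bullet> u" "v \<bullet> v = v \<bullet> u"
    using \<open>u \<noteq> 0\<close> \<open>v \<noteq> 0\<close> by (auto simp: eq_real2_iff)
  then have "(u - v) \<bullet> (u - v) = 0" by (simp add: inner_simps inner_commute)
  then show False using assms(3) by (simp add: u_def v_def)
qed

definition circumcenters :: "(real^2) set \<Rightarrow> (real^2) set" where
  "circumcenters A = {q. \<exists>a\<in>A. \<exists>b\<in>A. \<exists>c\<in>A. a \<noteq> b \<and> a \<noteq> c \<and> b \<noteq> c \<and>
     dist q a = dist q b \<and> dist q a = dist q c}"

lemma finite_circumcenters:
  assumes "finite A"
  shows "finite (circumcenters A)"
proof -
  define Q where "Q = (\<lambda>(a, b, c). {q :: real^2. a \<noteq> b \<and> a \<noteq> c \<and> b \<noteq> c \<and> dist q a = dist q b \<and> dist q a = dist q c})"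
  have "finite (Q (a, b, c))" for a b c
  proof (cases "\<exists>q. q \<in> Q (a, b, c)")
    case True
    then obtain q where q: "q \<in> Q (a, b, c)" by blast
    have "Q (a, b, c) \<subseteq> {q}"
      using q circumcenter_unique[of a b c] by (auto simp: Q_def)
    then show ?thesis using finite_subset by blast
  next
    case False
    then have "Q (a, b, c) = {}" by blast
    then show ?thesis by simp
  qed
  then have "finite (\<Union>z\<in>A \<times> A \<times> A. Q z)" using assms by auto
  moreover have "circumcenters A \<subseteq> (\<Union>z\<in>A \<times> A \<times> A. Q z)"
    by (force simp: circumcenters_def Q_def)
  ultimately show ?thesis by (rule rev_finite_subset)
qed

text \<open>Walking straight from \<open>p\<close> to \<open>p'\<close>, the nearest point outside \<open>N\<close> can only change when the
  bisector of a close pair is crossed, provided the path is perturbed to miss all circumcenters.\<close>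

lemma nearest_unchanged:
  assumes "finite A" "finite N" "card N < m"
    and inj: "inj_on (dist p) A" "inj_on (dist p') A"
    and same: "\<And>a b. (a, b) \<in> close_pairs A m \<Longrightarrow> dist p a < dist p b \<longleftrightarrow> dist p' a < dist p' b"
    and a: "a \<in> A - N" "\<And>y. y \<in> A - N \<Longrightarrow> dist p a \<le> dist p y"
    and a': "a' \<in> A - N" "\<And>y. y \<in> A - N \<Longrightarrow> dist p' a' \<le> dist p' y"
  shows "a = a'"
proof (rule ccontr)
  assume "a \<noteq> a'"
  define V where "V x = affine_val (voronoi x)" for x
  have V: "dist z x < dist z y \<longleftrightarrow> V x z < V y z" "dist z x \<le> dist z y \<longleftrightarrow> V x z \<le> V y z"
    "dist z x = dist z y \<longleftrightarrow> V x z = V y z" for x y z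
    by (simp_all add: V_def dist_less_voronoi dist_le_voronoi dist_eq_voronoi)
  \<comment> \<open>An open neighbourhood of \<open>p'\<close> on which all strict distance
    comparisons from \<open>p'\<close> persist.\<close>
  define S where "S = (\<Inter>z\<in>{(x, y). x \<in> A \<and> y \<in> A \<and> V x p' < V y p'}. {q. V (fst z) q < V (snd z) q})"
  have "finite {(x, y). x \<in> A \<and> y \<in> A \<and> V x p' < V y p'}"
    by (rule finite_subset[of _ "A \<times> A"]) (use assms(1) in auto)
  then have "open S" unfolding S_def V_def
    by (intro open_INT) (auto intro!: open_Collect_less continuous_affine_val)
  have "p' \<in> S" by (auto simp: S_def)
  have SD: "V x q < V y q" if "q \<in> S" "x \<in> A" "y \<in> A" "V x p' < V y p'" for x y q
    using that unfolding S_def by fastforce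
  \<comment> \<open>\<open>J q\<close> is \<open>q - p\<close> turned by a right angle, so
    \<open>H\<close> describes the lines joining \<open>p\<close> to the circumcenters. A target
    \<open>r\<close> off these lines gives a path that misses every circumcenter.\<close>
  define J where "J q = (vector [- (q - p) $ 2, (q - p) $ 1] :: real^2)" for q
  define H where "H = (\<lambda>q. (- (J q \<bullet> p), J q)) ` circumcenters A"
  have "p \<notin> circumcenters A" using inj(1) by (auto simp: circumcenters_def inj_on_def)
  then have "q $ 1 \<noteq> p $ 1 \<or> q $ 2 \<noteq> p $ 2" if "q \<in> circumcenters A" for q
    using that eq_real2_iff[of q p] by blast
  then have "J q \<noteq> 0" if "q \<in> circumcenters A" for q
    using that by (force simp: J_def eq_real2_iff)
  then have "\<exists>q\<in>S. \<forall>h\<in>H. affine_val h q \<noteq> 0"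
    using \<open>p' \<in> S\<close> by (intro open_avoid_hyperplanes[OF _ _ \<open>open S\<close>])
      (auto simp: H_def finite_circumcenters[OF assms(1)])
  then obtain r where r: "r \<in> S" "\<forall>h\<in>H. affine_val h r \<noteq> 0" by blast
  have off: "p + s *\<^sub>R (r - p) \<notin> circumcenters A" for s
  proof
    assume q: "p + s *\<^sub>R (r - p) \<in> circumcenters A" (is "?q \<in> _")
    have "affine_val (- (J ?q \<bullet> p), J ?q) r = J ?q \<bullet> (r - p)"
      by (simp add: affine_val_def inner_simps)
    also have "\<dots> = 0" by (simp add: J_def inner_real2 algebra_simps)
    finally show False using r(2) q unfolding H_def by blast
  qed
  define f where "f y s = V y (p + s *\<^sub>R (r - p)) - V a (p + s *\<^sub>R (r - p))" for y s
  have f_affine: "f y s = (1 - s) * f y 0 + s * f y 1" for y s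
    unfolding f_def V_def affine_val_line by (simp add: algebra_simps)
  have f0: "f y 0 > 0" if "y \<in> A - N" "y \<noteq> a" for y
  proof -
    have "V a p \<le> V y p" using a(2)[OF that(1)] by (simp add: V)
    moreover have "V a p \<noteq> V y p" using inj(1) that a(1) by (auto simp: inj_on_def V(3)[symmetric])
    ultimately show ?thesis by (simp add: f_def)
  qed
  define Y where "Y = {y \<in> A - N. f y 1 < 0}"
  have "V a' p' < V a p'"
  proof -
    have "V a' p' \<le> V a p'" using a'(2)[OF a(1)] by (simp add: V)
    moreover have "V a' p' \<noteq> V a p'"
      using inj(2) \<open>a \<noteq> a'\<close> a(1) a'(1) by (auto simp: inj_on_def V(3)[symmetric])
    ultimately show ?thesis by simp
  qed
  then have "a' \<in> Y" using SD[OF r(1), of a' a] a(1) a'(1) by (simp add: Y_def f_def)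
  moreover have "finite Y" using assms(1) by (simp add: Y_def)
  \<comment> \<open>Among the points outside \<open>N\<close> that are closer than \<open>a\<close>
    at the end of the path, \<open>y\<close> is one that overtakes \<open>a\<close> first.\<close>
  ultimately obtain y where "is_arg_min (\<lambda>y. f y 0 / (f y 0 - f y 1)) (\<lambda>y. y \<in> Y) y"
    using ex_is_arg_min_if_finite[of Y "\<lambda>y. f y 0 / (f y 0 - f y 1)"] by blast
  then have y: "y \<in> Y" "\<And>x. x \<in> Y \<Longrightarrow> f y 0 / (f y 0 - f y 1) \<le> f x 0 / (f x 0 - f x 1)"
    by (auto simp: is_arg_min_def not_less)
  have Y: "x \<in> A - N" "x \<noteq> a" "f x 1 < 0" "f x 0 > 0" if "x \<in> Y" for x
    using that f0[of x] by (auto simp: Y_def f_def)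
  define s where "s = f y 0 / (f y 0 - f y 1)"
  have s: "0 < s" "s < 1" using Y[OF y(1)] by (auto simp: s_def divide_simps)
  have fy: "f y s = 0"
    unfolding f_affine[of y s] using Y[OF y(1)] by (simp add: s_def field_simps)
  have fx: "f x s \<ge> 0" if x: "x \<in> A - N" for x
  proof (cases "x \<in> Y")
    case True
    then have "s \<le> f x 0 / (f x 0 - f x 1)" using y(2) by (simp add: s_def)
    then have "s * (f x 0 - f x 1) \<le> f x 0" using Y[OF True] by (simp add: pos_le_divide_eq)
    then show ?thesis unfolding f_affine[of x s] by (simp add: algebra_simps)
  next
    case False
    then have "f x 1 \<ge> 0" using x by (simp add: Y_def)
    moreover have "f x 0 \<ge> 0" using f0[OF x] by (cases "x = a") (auto simp: f_def)
    ultimately show ?thesis unfolding f_affine[of x s] using s by simp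
  qed
  define q where "q = p + s *\<^sub>R (r - p)"
  \<comment> \<open>At the moment of overtaking, only points of \<open>N\<close> are closer than
    \<open>a\<close>, and no third point is tied since \<open>q\<close> is not a
    circumcenter.\<close>
  have "(a, y) \<in> close_pairs A m"
  proof -
    have eq: "dist q a = dist q y" using fy by (simp add: V f_def q_def)
    have "x = a \<or> x = y" if "x \<in> A" "dist q x = dist q a" for x
      using off[of s] that eq Y[OF y(1)] a(1) unfolding q_def[symmetric] circumcenters_def by force
    moreover have "{x \<in> A. dist q x < dist q a} \<subseteq> N"
    proof
      fix x assume "x \<in> {x \<in> A. dist q x < dist q a}"
      then have "x \<in> A" "f x s < 0" by (auto simp: V f_def q_def)
      then show "x \<in> N" using fx[of x] by force
    qed
    then have "card {x \<in> A. dist q x < dist q a} < m"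
      using assms(2,3) card_mono by (meson le_less_trans)
    ultimately show ?thesis using eq a(1) Y[OF y(1)] unfolding close_pairs_def by blast
  qed
  moreover have "dist p a < dist p y" using Y(4)[OF y(1)] by (simp add: V f_def)
  ultimately have "V a p' < V y p'" using same by (simp add: V)
  then have "V a r < V y r" using SD[OF r(1)] a(1) Y(1)[OF y(1)] by blast
  then show False using Y(3)[OF y(1)] by (simp add: f_def)
qed

section \<open>Initial segments of the distance order\<close>

definition near_sets :: "(real^2) set \<Rightarrow> real^2 \<Rightarrow> (real^2) set set" where
  "near_sets A p = {N. N \<subseteq> A \<and> (\<forall>x\<in>N. \<forall>y\<in>A - N. dist p x < dist p y)}"

lemma near_sets_chain: "N \<in> near_sets A p \<Longrightarrow> N' \<in> near_sets A p \<Longrightarrow> N \<subseteq> N' \<or> N' \<subseteq> N"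
  unfolding near_sets_def by (smt (verit) Diff_iff mem_Collect_eq subset_eq)

text \<open>The segment is built one point at a time. Its farthest point \<open>a\<close> is the
  nearest one outside \<open>N - {a}\<close>, and by \<open>nearest_unchanged\<close> this is also
  the case at \<open>p'\<close>.\<close>

lemma near_sets_transfer:
  assumes "finite A"
    and inj: "inj_on (dist p) A" "inj_on (dist p') A"
    and same: "\<And>a b. (a, b) \<in> close_pairs A m \<Longrightarrow> dist p a < dist p b \<longleftrightarrow> dist p' a < dist p' b"
    and "N \<in> near_sets A p" "card N \<le> m"
  shows "N \<in> near_sets A p'"
  using assms(5,6)
proof (induction "card N" arbitrary: N)
  case 0
  then have "N = {}" using assms(1) finite_subset[of N A] by (auto simp: near_sets_def)
  then show ?case by (simp add: near_sets_def)
next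
  case (Suc k)
  have NA: "N \<subseteq> A" and near: "\<And>x y. x \<in> N \<Longrightarrow> y \<in> A - N \<Longrightarrow> dist p x < dist p y"
    using Suc.prems by (auto simp: near_sets_def)
  have finN: "finite N" "N \<noteq> {}" using Suc.hyps(2) card_gt_0_iff[of N] by auto
  obtain a where "is_arg_min (\<lambda>x. - dist p x) (\<lambda>x. x \<in> N) a"
    using ex_is_arg_min_if_finite[OF finN] by blast
  then have a: "a \<in> N" "\<And>x. x \<in> N \<Longrightarrow> dist p x \<le> dist p a"
    by (auto simp: is_arg_min_def not_less)
  define N0 where "N0 = N - {a}"
  have cN0: "card N0 = k" "finite N0" using Suc.hyps(2) finN a(1) by (simp_all add: N0_def)
  have lt: "dist p x < dist p a" if "x \<in> N0" for x
  proof -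
    have "dist p x \<noteq> dist p a" using inj(1) that a(1) NA by (auto simp: N0_def inj_on_def)
    then show ?thesis using a(2)[of x] that by (simp add: N0_def)
  qed
  have "N0 \<in> near_sets A p"
    using NA near lt by (auto simp: near_sets_def N0_def)
  then have N0': "N0 \<in> near_sets A p'" using Suc.hyps(1)[of N0] Suc.prems(2) Suc.hyps(2) cN0 by simp
  have aA: "a \<in> A - N0" using a(1) NA by (auto simp: N0_def)
  have near_a: "dist p a \<le> dist p y" if "y \<in> A - N0" for y
    using near[OF a(1), of y] that by (cases "y = a") (auto simp: N0_def)
  have "finite (A - N0)" "A - N0 \<noteq> {}" using assms(1) aA by auto
  then obtain a' where "is_arg_min (dist p') (\<lambda>x. x \<in> A - N0) a'"
    using ex_is_arg_min_if_finite[of "A - N0" "dist p'"] by blast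
  then have a': "a' \<in> A - N0" "\<And>y. y \<in> A - N0 \<Longrightarrow> dist p' a' \<le> dist p' y"
    by (auto simp: is_arg_min_def not_less)
  have "card N0 < m" using cN0 Suc.hyps(2) Suc.prems(2) by simp
  then have "a = a'"
    using nearest_unchanged[OF assms(1) cN0(2) _ inj same aA near_a a'] by blast
  have "dist p' x < dist p' y" if xy: "x \<in> N" "y \<in> A - N" for x y
  proof (cases "x = a")
    case True
    have "dist p' a \<le> dist p' y" using a'(2)[of y] xy \<open>a = a'\<close> by (auto simp: N0_def)
    moreover have "dist p' a \<noteq> dist p' y" using inj(2) xy a(1) NA by (auto simp: inj_on_def)
    ultimately show ?thesis using True by simp
  next
    case False
    then show ?thesis using N0' xy by (auto simp: near_sets_def N0_def)
  qed
  then show ?case using NA by (auto simp: near_sets_def)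
qed

section \<open>Optimal matchings\<close>

definition match_affine :: "(real^2) set \<Rightarrow> ((real^2) \<Rightarrow> (real^2)) \<Rightarrow> real \<times> (real^2)" where
  "match_affine B \<pi> = ((\<Sum>b\<in>B. (norm (b - \<pi> b))\<^sup>2), 2 *\<^sub>R (\<Sum>b\<in>B. b - \<pi> b))"

lemma match_cost_affine:
  "match_cost B \<pi> t = affine_val (match_affine B \<pi>) t + real (card B) * (norm t)\<^sup>2"
proof -
  have "(norm (b + t - \<pi> b))\<^sup>2 = (norm (b - \<pi> b))\<^sup>2 + 2 * ((b - \<pi> b) \<bullet> t) + (norm t)\<^sup>2" for b
    by (simp add: power2_norm_eq_inner inner_simps inner_commute)
  then show ?thesis
    by (simp add: match_cost_def match_affine_def affine_val_def sum.distrib inner_sum_left sum_distrib_left)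
qed

lemma finite_matchings: "finite A \<Longrightarrow> finite B \<Longrightarrow> finite (matchings B A)"
  by (rule finite_subset[of _ "B \<rightarrow>\<^sub>E A"]) (auto simp: matchings_def intro: finite_PiE)

lemma matchings_nonempty:
  assumes "finite A" "finite B" "card B \<le> card A"
  shows "matchings B A \<noteq> {}"
proof -
  obtain f where f: "inj_on f B" "f ` B \<subseteq> A" using assms inj_on_iff_card_le by metis
  have "restrict f B \<in> matchings B A" using f by (auto simp: matchings_def inj_on_def)
  then show ?thesis by blast
qed

lemma optimal_matchings_minimizers:
  "optimal_matchings B A t =
     {\<pi> \<in> matchings B A. match_affine B \<pi> \<in> minimizers (match_affine B ` matchings B A) t}"
  by (auto simp: optimal_matchings_def minimizers_def match_cost_affine)

text \<open>The set of optimal matchings is a function of the label of the envelope. Several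
  matchings may share one affine function, which does no harm here.\<close>

lemma pm_complexity_le_faces:
  assumes "finite A" "finite B"
  shows "pm_complexity B A \<le> card (range (minimizers (match_affine B ` matchings B A)))"
proof -
  let ?T = "match_affine B ` matchings B A"
  have "finite ?T" using assms by (simp add: finite_matchings)
  then have "finite (range (minimizers ?T))"
    by (rule finite_subset[of _ "Pow ?T", rotated, OF finite_Pow_iff[THEN iffD2]]) (use minimizersD(1) in blast)
  moreover have "pm_faces B A = (\<lambda>M. {\<pi> \<in> matchings B A. match_affine B \<pi> \<in> M}) ` range (minimizers ?T)"
    by (auto simp: pm_faces_def optimal_matchings_minimizers)
  ultimately show ?thesis unfolding pm_complexity_def by (simp add: card_image_le)
qed

text \<open>For a fixed image the gradient is fixed, so the cheapest matching does not depend on the translation.\<close>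

lemma match_affine_eq_if_same_image:
  assumes "\<pi> \<in> optimal_matchings B A t" "\<sigma> \<in> optimal_matchings B A u" "\<pi> ` B = \<sigma> ` B"
  shows "match_affine B \<pi> = match_affine B \<sigma>"
proof -
  have inj: "inj_on \<pi> B" "inj_on \<sigma> B" using assms by (auto simp: optimal_matchings_def matchings_def)
  have "sum \<pi> B = sum \<sigma> B"
    using sum.reindex[OF inj(1), of id] sum.reindex[OF inj(2), of id] assms(3) by simp
  then have grad: "snd (match_affine B \<pi>) = snd (match_affine B \<sigma>)"
    by (simp add: match_affine_def sum_subtractf)
  have "match_cost B \<pi> t \<le> match_cost B \<sigma> t" "match_cost B \<sigma> u \<le> match_cost B \<pi> u"
    using assms by (auto simp: optimal_matchings_def)
  then have "fst (match_affine B \<pi>) = fst (match_affine B \<sigma>)"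
    using grad by (simp add: match_cost_affine affine_val_def)
  with grad show ?thesis by (simp add: prod_eq_iff)
qed

text \<open>An unused point closer to \<open>b + t\<close> than \<open>\<pi> b\<close> would improve the matching.\<close>

lemma optimal_image_chain_union:
  assumes "finite A" "finite B" and opt: "\<pi> \<in> optimal_matchings B A t"
    and gen: "\<And>b. b \<in> B \<Longrightarrow> inj_on (dist (b + t)) A"
  obtains N where "\<And>b. b \<in> B \<Longrightarrow> N b \<in> near_sets A (b + t) \<and> card (N b) \<le> card B" "\<pi> ` B = (\<Union>b\<in>B. N b)"
proof -
  \<comment> \<open>The initial segment ending at \<open>\<pi> b\<close>; optimality keeps it inside
    the image.\<close>
  define N where "N b = {a \<in> A. dist (b + t) a \<le> dist (b + t) (\<pi> b)}" for b
  have \<pi>: "\<pi> \<in> B \<rightarrow>\<^sub>E A" "inj_on \<pi> B" using opt by (auto simp: optimal_matchings_def matchings_def)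
  have sub: "N b \<subseteq> \<pi> ` B" if b: "b \<in> B" for b
  proof (rule subsetI, rule ccontr)
    fix a assume a: "a \<in> N b" "a \<notin> \<pi> ` B"
    have "\<pi> b \<in> A" using \<pi>(1) b by auto
    then have "dist (b + t) a \<noteq> dist (b + t) (\<pi> b)"
      using inj_onD[OF gen[OF b], of a "\<pi> b"] a b by (auto simp: N_def)
    then have closer: "dist (b + t) a < dist (b + t) (\<pi> b)" using a by (auto simp: N_def)
    define \<sigma> where "\<sigma> = \<pi>(b := a)"
    have "\<sigma> \<in> matchings B A"
    proof -
      have "a \<in> A" using a by (simp add: N_def)
      then have "\<sigma> \<in> B \<rightarrow>\<^sub>E A" using \<pi>(1) b by (auto simp: \<sigma>_def PiE_def extensional_def Pi_def)
      moreover have "inj_on \<sigma> B" using \<pi>(2) a(2) by (auto simp: \<sigma>_def inj_on_def)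
      ultimately show ?thesis by (simp add: matchings_def)
    qed
    then have "match_cost B \<pi> t \<le> match_cost B \<sigma> t" using opt by (simp add: optimal_matchings_def)
    moreover have "match_cost B \<sigma> t < match_cost B \<pi> t"
    proof -
      have "(\<Sum>c\<in>B - {b}. (norm (c + t - \<sigma> c))\<^sup>2) = (\<Sum>c\<in>B - {b}. (norm (c + t - \<pi> c))\<^sup>2)"
        by (rule sum.cong) (auto simp: \<sigma>_def)
      moreover have "(norm (b + t - \<sigma> b))\<^sup>2 < (norm (b + t - \<pi> b))\<^sup>2"
        using closer by (simp add: \<sigma>_def dist_norm power_strict_mono)
      ultimately show ?thesis
        unfolding match_cost_def sum.remove[OF assms(2) b] by simp
    qed
    ultimately show False by simp
  qed
  have "N b \<in> near_sets A (b + t) \<and> card (N b) \<le> card B" if b: "b \<in> B" for b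
  proof
    show "N b \<in> near_sets A (b + t)" by (auto simp: N_def near_sets_def)
    show "card (N b) \<le> card B"
      using card_mono[OF finite_imageI[OF assms(2)] sub[OF b]] card_image_le[OF assms(2), of \<pi>] by linarith
  qed
  moreover have "\<pi> ` B = (\<Union>b\<in>B. N b)"
  proof (intro equalityI subsetI)
    fix a assume "a \<in> \<pi> ` B"
    then obtain b where "b \<in> B" "a = \<pi> b" by blast
    then show "a \<in> (\<Union>b\<in>B. N b)" using \<pi>(1) by (auto simp: N_def)
  qed (use sub in blast)
  ultimately show thesis using that by blast
qed

text \<open>As a function of the translation, it vanishes on the bisector of \<open>x\<close> and
  \<open>y\<close> shifted by \<open>- b\<close>.\<close>

definition bisector :: "(real^2) \<times> (real^2) \<times> (real^2) \<Rightarrow> real \<times> (real^2)" where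
  "bisector = (\<lambda>(b, x, y). (affine_val (voronoi y) b - affine_val (voronoi x) b, 2 *\<^sub>R (x - y)))"

lemma affine_val_bisector:
  "affine_val (bisector (b, x, y)) t = affine_val (voronoi y) (b + t) - affine_val (voronoi x) (b + t)"
  by (simp add: bisector_def affine_val_def voronoi_def inner_simps algebra_simps)

lemma bisector_pos: "affine_val (bisector (b, x, y)) t > 0 \<longleftrightarrow> dist (b + t) x < dist (b + t) y"
  by (simp add: affine_val_bisector dist_less_voronoi)

lemma bisector_zero: "affine_val (bisector (b, x, y)) t = 0 \<longleftrightarrow> dist (b + t) x = dist (b + t) y"
  by (auto simp: affine_val_bisector dist_eq_voronoi)

text \<open>The signs of the shifted bisectors of close pairs determine all initial segments of size
  at most m. So each cell contributes at most \<open>4 ^ m\<close> images, and the number of cells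
  is at most the square of \<open>49 * m * card A * 2 ^ m\<close>.\<close>

lemma card_generic_optimal_images:
  assumes "finite A" "finite B" "1 \<le> card B" "1 \<le> card A"
  defines "generic \<equiv> {t. \<forall>b\<in>B. inj_on (dist (b + t)) A}"
  defines "\<S> \<equiv> {\<pi> ` B | \<pi> t. t \<in> generic \<and> \<pi> \<in> optimal_matchings B A t}"
  shows "finite \<S>" "card \<S> \<le> 2401 * (card B)\<^sup>2 * (card A)\<^sup>2 * 16 ^ card B"
proof -
  define m where "m = card B"
  define I where "I = B \<times> close_pairs A m"
  have "finite (close_pairs A m)" using close_pairs_subset assms(1) finite_subset by blast
  then have finI: "finite I" using assms(2) by (simp add: I_def)
  define pat where "pat t = {i \<in> I. affine_val (bisector i) t > 0}" for t
  \<comment> \<open>One generic translation is fixed for each sign pattern, so that the chains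
    depend on the pattern only.\<close>
  define rep where "rep P = (SOME t. t \<in> generic \<and> pat t = P)" for P
  have rep: "rep (pat t) \<in> generic" "pat (rep (pat t)) = pat t" if "t \<in> generic" for t
    using someI[of "\<lambda>u. u \<in> generic \<and> pat u = pat t" t] that by (auto simp: rep_def)
  define C where "C P = chain_unions (\<lambda>b. near_sets A (b + rep P)) B m" for P
  have cover: "\<S> \<subseteq> (\<Union>P\<in>pat ` generic. C P)"
  proof
    fix S assume "S \<in> \<S>"
    then obtain \<pi> t where S: "S = \<pi> ` B" "t \<in> generic" "\<pi> \<in> optimal_matchings B A t"
      by (auto simp: \<S>_def)
    obtain N where N: "\<And>b. b \<in> B \<Longrightarrow> N b \<in> near_sets A (b + t) \<and> card (N b) \<le> m" "S = (\<Union>b\<in>B. N b)"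
      using optimal_image_chain_union[OF assms(1,2) S(3)] S(1,2) by (auto simp: m_def generic_def)
    define u where "u = rep (pat t)"
    have u: "u \<in> generic" "pat u = pat t" using rep[OF S(2)] by (auto simp: u_def)
    have "N b \<in> near_sets A (b + u)" if b: "b \<in> B" for b
    proof (rule near_sets_transfer[OF assms(1)])
      show "inj_on (dist (b + t)) A" "inj_on (dist (b + u)) A" using S(2) u(1) b by (auto simp: generic_def)
      show "N b \<in> near_sets A (b + t)" "card (N b) \<le> m" using N(1)[OF b] by auto
      fix x y assume xy: "(x, y) \<in> close_pairs A m"
      have "(b, x, y) \<in> pat t \<longleftrightarrow> (b, x, y) \<in> pat u" using u by simp
      then show "dist (b + t) x < dist (b + t) y \<longleftrightarrow> dist (b + u) x < dist (b + u) y"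
        using b xy by (simp add: pat_def I_def bisector_pos)
    qed
    moreover have "inj_on \<pi> B" using S by (auto simp: optimal_matchings_def matchings_def)
    then have "finite S" "card S = m" using S assms(2) by (auto simp: card_image m_def)
    ultimately have "S \<in> C (pat t)" using N(2) by (auto simp: C_def chain_unions_def u_def)
    then show "S \<in> (\<Union>P\<in>pat ` generic. C P)" using S(2) by blast
  qed
  have C: "finite (C P) \<and> card (C P) \<le> 2 ^ (m + m)" for P
    unfolding C_def m_def by (rule card_chain_unions[OF assms(2) near_sets_chain])
  have patI: "pat ` generic \<subseteq> sign_patterns bisector UNIV I"
  proof
    fix P assume "P \<in> pat ` generic"
    then obtain t where t: "t \<in> generic" "P = pat t" by blast
    have "affine_val (bisector i) t \<noteq> 0" if "i \<in> I" for i
    proof -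
      obtain b x y where i: "i = (b, x, y)" "b \<in> B" "(x, y) \<in> close_pairs A m"
        using \<open>i \<in> I\<close> by (auto simp: I_def)
      then have "x \<in> A" "y \<in> A" "x \<noteq> y" by (auto simp: close_pairs_def)
      then show ?thesis using t(1) i by (auto simp: bisector_zero generic_def inj_on_def)
    qed
    then show "P \<in> sign_patterns bisector UNIV I"
      unfolding sign_patterns_def t(2) pat_def by blast
  qed
  have finp: "finite (pat ` generic)" using patI finite_sign_patterns[OF finI] finite_subset by blast
  have finU: "finite (\<Union>P\<in>pat ` generic. C P)"
    by (rule finite_UN_I[OF finp]) (use C in blast)
  then show "finite \<S>" using cover finite_subset by blast
  have "card (pat ` generic) \<le> card (sign_patterns bisector UNIV I)"
    by (rule card_mono[OF finite_sign_patterns[OF finI] patI])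
  also have "\<dots> \<le> (card I + 1)\<^sup>2"
  proof (rule card_sign_patterns_plane[OF finI])
    fix i assume "i \<in> I"
    then obtain b x y where i: "i = (b, x, y)" "(x, y) \<in> close_pairs A m" by (auto simp: I_def)
    then have "x \<noteq> y" by (auto simp: close_pairs_def)
    then show "snd (bisector i) \<noteq> 0" by (simp add: i bisector_def)
  qed
  \<comment> \<open>The summand 1 is absorbed by raising 48 to 49, as
    \<open>m * card A * 2 ^ m\<close> is at least 1.\<close>
  also have "\<dots> \<le> (49 * m * card A * 2 ^ m)\<^sup>2"
  proof (rule power_mono)
    have "card I \<le> m * (48 * card A * 2 ^ m)"
      unfolding I_def card_cartesian_product m_def[symmetric]
      using card_close_pairs[OF assms(1), of m] by (rule mult_le_mono2)
    also have "\<dots> = 48 * (m * card A * 2 ^ m)" by simp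
    finally have "card I + 1 \<le> 48 * (m * card A * 2 ^ m) + 1" by simp
    also have "\<dots> \<le> 48 * (m * card A * 2 ^ m) + m * card A * 2 ^ m"
      using assms(3,4) by (simp add: m_def)
    also have "\<dots> = 49 * m * card A * 2 ^ m" by simp
    finally show "card I + 1 \<le> 49 * m * card A * 2 ^ m" .
  qed simp
  finally have pats: "card (pat ` generic) \<le> (49 * m * card A * 2 ^ m)\<^sup>2" .
  have "card \<S> \<le> card (\<Union>P\<in>pat ` generic. C P)"
    by (rule card_mono[OF finU cover])
  also have "\<dots> \<le> (\<Sum>P\<in>pat ` generic. card (C P))" by (rule card_UN_le[OF finp])
  also have "\<dots> \<le> (\<Sum>P\<in>pat ` generic. 2 ^ (m + m))" using C by (intro sum_mono) blast
  also have "\<dots> = card (pat ` generic) * 2 ^ (m + m)" by simp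
  also have "\<dots> \<le> (49 * m * card A * 2 ^ m)\<^sup>2 * 2 ^ (m + m)" using pats by (rule mult_le_mono1)
  also have "\<dots> = 2401 * m\<^sup>2 * (card A)\<^sup>2 * (2 ^ m * 2 ^ m * (2 ^ m * 2 ^ m))"
    by (simp add: power2_eq_square power_add)
  also have "2 ^ m * 2 ^ m * (2 ^ m * 2 ^ m) = (16::nat) ^ m"
    by (simp flip: power_mult_distrib)
  finally show "card \<S> \<le> 2401 * (card B)\<^sup>2 * (card A)\<^sup>2 * 16 ^ card B" by (simp add: m_def)
qed

text \<open>A function minimal at a generic translation is determined by the image of its matching,
  so counting images suffices. The constant is 6 times 2401.\<close>

lemma pm_complexity_bound:
  assumes "finite A" "finite B" "1 \<le> card B" "card B \<le> card A"
  shows "pm_complexity B A \<le> 14406 * (card B)\<^sup>2 * (card A)\<^sup>2 * 16 ^ card B"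
proof -
  define T where "T = match_affine B ` matchings B A"
  \<comment> \<open>All pairs of \<open>A\<close> are taken here, not only close ones, so that off
    these lines the distances from each \<open>b + t\<close> are distinct.\<close>
  define H where "H = bisector ` {(b, x, y). b \<in> B \<and> x \<in> A \<and> y \<in> A \<and> x \<noteq> y}"
  define generic where "generic = {t. \<forall>b\<in>B. inj_on (dist (b + t)) A}"
  define \<S> where "\<S> = {\<pi> ` B | \<pi> t. t \<in> generic \<and> \<pi> \<in> optimal_matchings B A t}"
  define U where "U = {g. \<exists>q. (\<forall>h\<in>H. affine_val h q \<noteq> 0) \<and> g \<in> minimizers T q}"
  have "finite {(b, x, y). b \<in> B \<and> x \<in> A \<and> y \<in> A \<and> x \<noteq> y}"
    by (rule finite_subset[of _ "B \<times> A \<times> A"]) (use assms in auto)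
  then have finH: "finite H" by (simp add: H_def)
  have H0: "snd h \<noteq> 0" if "h \<in> H" for h using that by (auto simp: H_def bisector_def)
  have gen: "q \<in> generic" if "\<forall>h\<in>H. affine_val h q \<noteq> 0" for q
  proof -
    have "x = y" if "b \<in> B" "x \<in> A" "y \<in> A" "dist (b + q) x = dist (b + q) y" for b x y
    proof (rule ccontr)
      assume "x \<noteq> y"
      then have "bisector (b, x, y) \<in> H" using that by (auto simp: H_def)
      then show False using \<open>\<forall>h\<in>H. affine_val h q \<noteq> 0\<close> that(4) bisector_zero by blast
    qed
    then show ?thesis by (auto simp: generic_def inj_on_def)
  qed
  have "\<exists>S\<in>\<S>. \<exists>\<pi> t. S = \<pi> ` B \<and> \<pi> \<in> optimal_matchings B A t \<and> match_affine B \<pi> = g" if "g \<in> U" for g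
  proof -
    obtain q where q: "\<forall>h\<in>H. affine_val h q \<noteq> 0" "g \<in> minimizers T q" using \<open>g \<in> U\<close> by (auto simp: U_def)
    then obtain \<pi> where "\<pi> \<in> matchings B A" "g = match_affine B \<pi>"
      using minimizersD(1)[of g T q] by (auto simp: T_def)
    then have "\<pi> \<in> optimal_matchings B A q" using q(2) by (simp add: optimal_matchings_minimizers T_def)
    then show ?thesis using gen[OF q(1)] \<open>g = _\<close> unfolding \<S>_def by blast
  qed
  then obtain f where f: "\<And>g. g \<in> U \<Longrightarrow> f g \<in> \<S> \<and>
      (\<exists>\<pi> t. f g = \<pi> ` B \<and> \<pi> \<in> optimal_matchings B A t \<and> match_affine B \<pi> = g)"
    by metis
  have "inj_on f U"
  proof (rule inj_onI)
    fix g h assume "g \<in> U" "h \<in> U" "f g = f h"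
    then show "g = h" using f match_affine_eq_if_same_image by metis
  qed
  moreover have "f ` U \<subseteq> \<S>" using f by blast
  moreover have \<S>: "finite \<S>" "card \<S> \<le> 2401 * (card B)\<^sup>2 * (card A)\<^sup>2 * 16 ^ card B"
    unfolding \<S>_def generic_def using card_generic_optimal_images[of A B] assms by auto
  ultimately have "card U \<le> card \<S>" by (intro card_inj_on_le)
  moreover have "finite T" "T \<noteq> {}"
    using assms by (auto simp: T_def finite_matchings matchings_nonempty)
  then have "card (range (minimizers T)) \<le> 6 * card U"
    unfolding U_def by (intro faces_card_generic finH H0)
  ultimately show ?thesis
    using pm_complexity_le_faces[OF assms(1,2)] \<S>(2) unfolding T_def by linarith
qed

text \<open>Once \<open>ln m\<close> reaches 16 the base on the right is at least 16. Smaller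
  \<open>m\<close> are bounded by \<open>M\<close>, and the constant \<open>16 ^ M\<close> suffices
  for them because the base is always at least 1.\<close>

lemma power_le_log_power:
  "\<exists>K::real. K > 0 \<and> (\<forall>m\<ge>1. 16 ^ m \<le> K * (exp 1 * ln (real m) + exp 1) ^ m)"
proof (intro exI conjI allI impI)
  define M where "M = nat \<lceil>exp (16::real)\<rceil>"
  show "(0::real) < 16 ^ M" by simp
  fix m :: nat assume "1 \<le> m"
  define x where "x = exp 1 * ln (real m) + exp (1::real)"
  have e: "exp (1::real) \<ge> 1" by simp
  have ln0: "ln (real m) \<ge> 0" using \<open>1 \<le> m\<close> by simp
  have x1: "x \<ge> 1" using e ln0 by (simp add: x_def add_increasing)
  show "16 ^ m \<le> 16 ^ M * (exp 1 * ln (real m) + exp 1) ^ m"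
  proof (cases "ln (real m) \<ge> 16")
    case True
    then have "1 * 16 \<le> exp 1 * ln (real m)" using e by (intro mult_mono) auto
    then have "16 \<le> x" using e unfolding x_def by linarith
    then have "16 ^ m \<le> x ^ m" by (intro power_mono) auto
    also have "\<dots> \<le> 16 ^ M * x ^ m" using x1 mult_right_mono[of 1 "16 ^ M" "x ^ m"] by simp
    finally show ?thesis by (simp add: x_def)
  next
    case False
    then have "real m < exp 16" using \<open>1 \<le> m\<close> by (metis exp_less_mono exp_ln not_le of_nat_0_less_iff less_le_trans zero_less_one)
    then have "m \<le> M" unfolding M_def by linarith
    then have "(16::real) ^ m \<le> 16 ^ M" by (intro power_increasing) auto
    also have "\<dots> \<le> 16 ^ M * x ^ m" using one_le_power[OF x1, of m] by simp
    finally show ?thesis by (simp add: x_def)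
  qed
qed

theorem theorem2:
  shows "\<exists>C::real. \<forall>(A::(real^2) set) (B::(real^2) set).
           finite A \<and> finite B \<and> 1 \<le> card B \<and> card B \<le> card A \<longrightarrow>
           real (pm_complexity B A)
             \<le> C * real (card A) ^ 2 * real (card B) powr (7/2)
                 * (exp 1 * ln (real (card B)) + exp 1) ^ card B"
proof -
  obtain K :: real where K: "K > 0" "\<And>m. m \<ge> 1 \<Longrightarrow> 16 ^ m \<le> K * (exp 1 * ln (real m) + exp 1) ^ m"
    using power_le_log_power by blast
  show ?thesis
  proof (intro exI allI impI)
    fix A B :: "(real^2) set"
    assume asm: "finite A \<and> finite B \<and> 1 \<le> card B \<and> card B \<le> card A"
    define m n where "m = card B" and "n = card A"
    have "pm_complexity B A \<le> 14406 * m\<^sup>2 * n\<^sup>2 * 16 ^ m"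
      unfolding m_def n_def using asm by (intro pm_complexity_bound) auto
    then have "real (pm_complexity B A) \<le> real (14406 * m\<^sup>2 * n\<^sup>2 * 16 ^ m)" by (rule of_nat_mono)
    also have "\<dots> = (14406 * (real n)\<^sup>2 * (real m)\<^sup>2) * 16 ^ m" by simp
    also have "\<dots> \<le> (14406 * (real n)\<^sup>2 * real m powr (7/2)) * (K * (exp 1 * ln (real m) + exp 1) ^ m)"
    proof (intro mult_mono K)
      show "m \<ge> 1" using asm by (simp add: m_def)
      then have "real m powr 2 \<le> real m powr (7/2)" by (intro powr_mono) auto
      then show "(real m)\<^sup>2 \<le> real m powr (7/2)" using \<open>m \<ge> 1\<close> by (simp add: powr_numeral)
    qed auto
    finally show "real (pm_complexity B A) \<le> (14406 * K) * real (card A) ^ 2 * real (card B) powr (7/2)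
        * (exp 1 * ln (real (card B)) + exp 1) ^ card B"
      by (simp add: m_def n_def mult_ac)
  qed
qed

end
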